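(* Let $f\in\mathbb{Z}[t]$ be a polynomial whose leading and constant coefficients are invertible (in $\mathbb{Z}$). Let $X$ be a set, let $z\in X$ and $X^-=X\smallsetminus\{z\}$. Let $M=\bigoplus_{s\in X^-}\mathbb{Z}[t]/(f)$, let $\{e_i;\ i\in X^-\}$ be a free basis of the $\mathbb{Z}[t]/(f)$-module $M$ (indexed by $X^-$), and let $e_z=0\in M$. Let $F$ be the set $M\times X$ equipped with the operation $$(a,i)\ast(b,j)=\big((1-t)\cdot a+t\cdot b+e_i-e_j,\ j\big).$$ Then $(F,\ast)$ is a free $f$-quandle over $\{(0,i);\ i\in X\}$.
   Context: A quandle is a set $Q$ with a binary operation $\ast$ such that, for all $x,y,z\in Q$: $x\ast(y\ast z)=(x\ast y)\ast(x\ast z)$; the equation $x\ast u=y$ has a unique solution $u\in Q$, denoted $x\backslash y$; and $x\ast x=x$. It is medial if $(x\ast y)\ast(u\ast v)=(x\ast u)\ast(y\ast v)$ for all $x,y,u,v\in Q$. The left translation $L_x(y)=x\ast y$ is a permutation of $Q$, and the displacement group is $\mathrm{Dis}(Q)=\langle L_xL_y^{-1};\ x,y\in Q\rangle$. If $Q$ is medial, $\mathrm{Dis}(Q)$ is abelian, and for $\alpha\in\mathrm{Dis}(Q)$ the element $\alpha^{L}:=L_x\alpha L_x^{-1}\in\mathrm{Dis}(Q)$ does not depend on $x\in Q$; $\mathrm{Dis}(Q)$ is a $\mathbb{Z}[t,t^{-1}]$-module with $t$ acting by $\alpha\mapsto\alpha^L$, the action of $f=\sum_r c_rt^r$ being written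 $\alpha\mapsto\alpha^f=\prod_r(L_x^r\alpha L_x^{-r})^{c_r}$. An $f$-quandle is a medial quandle $Q$ such that $\alpha^f=1$ for each $\alpha\in\mathrm{Dis}(Q)$. An $f$-quandle $F$ is free over a subset $Y\subset F$ if $Y$ generates $F$ (under $\ast$ and $\backslash$) and every map from $Y$ to an $f$-quandle extends to a quandle homomorphism from $F$. *)

theory Defs
  imports "HOL-Algebra.Algebra" "HOL-Algebra.Algebraic_Closure_Type"
    "HOL-Computational_Algebra.Polynomial"
begin

section \<open>Medial quandles and the action of polynomials on displacement groups\<close>

locale quandle =
  fixes Q :: "'q set" and star :: "'q \<Rightarrow> 'q \<Rightarrow> 'q" (infixl "\<star>" 70)
  assumes star_closed: "x \<in> Q \<Longrightarrow> y \<in> Q \<Longrightarrow> x \<star> y \<in> Q"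
    and left_distrib: "x \<in> Q \<Longrightarrow> y \<in> Q \<Longrightarrow> w \<in> Q \<Longrightarrow> x \<star> (y \<star> w) = (x \<star> y) \<star> (x \<star> w)"
    and left_division: "x \<in> Q \<Longrightarrow> y \<in> Q \<Longrightarrow> \<exists>!u. u \<in> Q \<and> x \<star> u = y"
    and idem: "x \<in> Q \<Longrightarrow> x \<star> x = x"
begin

definition left_div :: "'q \<Rightarrow> 'q \<Rightarrow> 'q"
  where "left_div x y = (THE u. u \<in> Q \<and> x \<star> u = y)"

definition left_translation :: "'q \<Rightarrow> 'q \<Rightarrow> 'q"
  where "left_translation x = (\<lambda>y\<in>Q. x \<star> y)"

definition Dis :: "('q \<Rightarrow> 'q) monoid"
  where "Dis = (BijGroup Q)
    \<lparr>carrier := generate (BijGroup Q)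
      {left_translation x \<otimes>\<^bsub>BijGroup Q\<^esub> inv\<^bsub>BijGroup Q\<^esub> left_translation y | x y. x \<in> Q \<and> y \<in> Q}\<rparr>"

text \<open>
  \<open>poly_action f x \<alpha>\<close> is the element written $\alpha^f$, computed with the translation by \<open>x\<close>.
  It is meaningful for medial quandles: then \<open>Dis\<close> is abelian, so that the product
  over \<open>r\<close> makes sense, and the result does not depend on \<open>x \<in> Q\<close>.
\<close>
definition poly_action :: "int poly \<Rightarrow> 'q \<Rightarrow> ('q \<Rightarrow> 'q) \<Rightarrow> ('q \<Rightarrow> 'q)"
  where "poly_action f x \<alpha> =
    (\<Otimes>\<^bsub>Dis\<^esub> r \<in> {..Polynomial.degree f}.
      (left_translation x [^]\<^bsub>BijGroup Q\<^esub> r \<otimes>\<^bsub>BijGroup Q\<^esub> \<alpha>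
        \<otimes>\<^bsub>BijGroup Q\<^esub> inv\<^bsub>BijGroup Q\<^esub> (left_translation x [^]\<^bsub>BijGroup Q\<^esub> r))
      [^]\<^bsub>BijGroup Q\<^esub> (Polynomial.coeff f r))"

inductive_set generated :: "'q set \<Rightarrow> 'q set" for Y
  where
    base: "y \<in> Y \<Longrightarrow> y \<in> generated Y"
  | star: "x \<in> generated Y \<Longrightarrow> y \<in> generated Y \<Longrightarrow> x \<star> y \<in> generated Y"
  | left_div: "x \<in> generated Y \<Longrightarrow> y \<in> generated Y \<Longrightarrow> left_div x y \<in> generated Y"

end

locale medial_quandle = quandle +
  assumes medial: "x \<in> Q \<Longrightarrow> y \<in> Q \<Longrightarrow> u \<in> Q \<Longrightarrow> v \<in> Q \<Longrightarrow>
    (x \<star> y) \<star> (u \<star> v) = (x \<star> u) \<star> (y \<star> v)"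

locale f_quandle = medial_quandle Q star
  for f :: "int poly" and Q :: "'q set" and star :: "'q \<Rightarrow> 'q \<Rightarrow> 'q" (infixl "\<star>" 70) +
  assumes poly_action_trivial: "\<alpha> \<in> carrier Dis \<Longrightarrow> x \<in> Q \<Longrightarrow> poly_action f x \<alpha> = \<one>\<^bsub>Dis\<^esub>"

definition quandle_hom ::
  "'p set \<Rightarrow> ('p \<Rightarrow> 'p \<Rightarrow> 'p) \<Rightarrow> 'q set \<Rightarrow> ('q \<Rightarrow> 'q \<Rightarrow> 'q) \<Rightarrow> ('p \<Rightarrow> 'q) set"
  where "quandle_hom P star\<^sub>P Q star\<^sub>Q =
    {h \<in> P \<rightarrow> Q. \<forall>x\<in>P. \<forall>y\<in>P. h (star\<^sub>P x y) = star\<^sub>Q (h x) (h y)}"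

text \<open>
  The type argument is the type over which the carriers of the target quandles range.
  HOL has no quantifier over types, so a freeness theorem is to be stated for an arbitrary \<open>'q\<close>.
\<close>
definition free_f_quandle ::
  "'q itself \<Rightarrow> int poly \<Rightarrow> 'p set \<Rightarrow> ('p \<Rightarrow> 'p \<Rightarrow> 'p) \<Rightarrow> 'p set \<Rightarrow> bool"
  where "free_f_quandle TYPE('q) f F star Y \<longleftrightarrow>
    f_quandle f F star \<and> Y \<subseteq> F \<and> quandle.generated F star Y = F \<and>
    (\<forall>(Q :: 'q set) star\<^sub>Q \<phi>. f_quandle f Q star\<^sub>Q \<longrightarrow> \<phi> \<in> Y \<rightarrow> Q \<longrightarrow>
      (\<exists>h \<in> quandle_hom F star Q star\<^sub>Q. \<forall>y\<in>Y. h y = \<phi> y))"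


section \<open>Free modules over quotients of the integer polynomial ring\<close>

abbreviation Zt :: "int poly ring"
  where "Zt \<equiv> ring_of_type_algebra"

definition Zt_quot :: "int poly \<Rightarrow> int poly set ring"
  where "Zt_quot f = Zt Quot (PIdl\<^bsub>Zt\<^esub> f)"

definition Zt_class :: "int poly \<Rightarrow> int poly \<Rightarrow> int poly set"
  where "Zt_class f p = (PIdl\<^bsub>Zt\<^esub> f) +>\<^bsub>Zt\<^esub> p"

text \<open>
  The direct sum of copies of \<open>R\<close> indexed by \<open>I\<close>. The fields \<open>mult\<close> and \<open>one\<close> of the record
  are not part of a module structure.
\<close>
definition direct_sum_copies :: "('r, 'm) ring_scheme \<Rightarrow> 'i set \<Rightarrow> ('r, 'i \<Rightarrow> 'r) module"
  where "direct_sum_copies R I =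
    \<lparr>carrier = {a \<in> I \<rightarrow>\<^sub>E carrier R. finite {i \<in> I. a i \<noteq> \<zero>\<^bsub>R\<^esub>}},
     monoid.mult = undefined,
     monoid.one = undefined,
     ring.zero = (\<lambda>i\<in>I. \<zero>\<^bsub>R\<^esub>),
     ring.add = (\<lambda>a b. \<lambda>i\<in>I. a i \<oplus>\<^bsub>R\<^esub> b i),
     module.smult = (\<lambda>r a. \<lambda>i\<in>I. r \<otimes>\<^bsub>R\<^esub> a i)\<rparr>"

text \<open>
  A family \<open>e\<close> indexed by \<open>I\<close> is a free basis if each element of \<open>M\<close> is a linear combination
  of it for a unique finitely supported family \<open>c\<close> of coefficients.
\<close>
definition free_basis ::
  "('r, 'm) ring_scheme \<Rightarrow> ('r, 'a, 'n) module_scheme \<Rightarrow> 'i set \<Rightarrow> ('i \<Rightarrow> 'a) \<Rightarrow> bool"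
  where "free_basis R M I e \<longleftrightarrow>
    e \<in> I \<rightarrow> carrier M \<and>
    (\<forall>a \<in> carrier M. \<exists>!c. c \<in> I \<rightarrow>\<^sub>E carrier R \<and> finite {i \<in> I. c i \<noteq> \<zero>\<^bsub>R\<^esub>} \<and>
      a = (\<Oplus>\<^bsub>M\<^esub> i \<in> {i \<in> I. c i \<noteq> \<zero>\<^bsub>R\<^esub>}. c i \<odot>\<^bsub>M\<^esub> e i))"

text \<open>The operation $(a,i)*(b,j)=((1-t)a+tb+e_i-e_j, j)$ on $M\times X$, for a scalar \<open>t\<close>.\<close>
definition affine_star ::
  "('r, 'm) ring_scheme \<Rightarrow> ('r, 'a, 'n) module_scheme \<Rightarrow> 'r \<Rightarrow> ('i \<Rightarrow> 'a) \<Rightarrow>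
    'a \<times> 'i \<Rightarrow> 'a \<times> 'i \<Rightarrow> 'a \<times> 'i"
  where "affine_star R M t e = (\<lambda>(a, i) (b, j).
    ((((\<one>\<^bsub>R\<^esub> \<ominus>\<^bsub>R\<^esub> t) \<odot>\<^bsub>M\<^esub> a \<oplus>\<^bsub>M\<^esub> t \<odot>\<^bsub>M\<^esub> b) \<oplus>\<^bsub>M\<^esub> e i) \<ominus>\<^bsub>M\<^esub> e j, j))"

end

theory Submission
  imports Defs
begin

text \<open>
  In \<open>F\<close> the permutation \<open>L\<^sub>x L\<^sub>y\<^sup>-\<^sup>1\<close> with \<open>x = (a, i)\<close>, \<open>y = (b, k)\<close> is the translation
  \<open>(c, j) \<mapsto> (c + (1 - t)a - (1 - t)b + e\<^sub>i - e\<^sub>k, j)\<close>, and conjugation by \<open>L\<^sub>x\<close> multiplies the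
  translation vector by \<open>t\<close>. Hence \<open>f\<close> kills the displacement group because it kills \<open>M\<close>.
  The vectors whose translations preserve the subquandle generated by the \<open>(0, i)\<close> form a submodule
  that contains the basis, so this subquandle is \<open>F\<close>.
  For a map \<open>(0, i) \<mapsto> x\<^sub>i\<close> into an \<open>f\<close>-quandle \<open>Q\<close>, the group \<open>Dis(Q)\<close> is a module over
  \<open>\<int>[t]/(f)\<close>; with the linear map \<open>\<psi> : M \<rightarrow> Dis(Q)\<close> that sends \<open>e\<^sub>i\<close> to
  \<open>L x\<^sub>i (L x\<^sub>z)\<^sup>-\<^sup>1\<close>, the extension is \<open>(a, i) \<mapsto> \<psi>(a)(x\<^sub>i)\<close>.
\<close>

section \<open>The action of integer polynomials through an endomorphism\<close>

text \<open>The same product as in \<open>poly_action\<close>, with conjugation replaced by any map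
  \<open>\<tau>\<close>. It serves both for \<open>Dis\<close> with conjugation by a left
  translation and for the additive group of a module with multiplication by t.\<close>

definition poly_act :: "('a, 'b) monoid_scheme \<Rightarrow> ('a \<Rightarrow> 'a) \<Rightarrow> int poly \<Rightarrow> 'a \<Rightarrow> 'a"
  where "poly_act G \<tau> p a =
    (\<Otimes>\<^bsub>G\<^esub> r \<in> {..Polynomial.degree p}. (\<tau> ^^ r) a [^]\<^bsub>G\<^esub> Polynomial.coeff p r)"

locale comm_group_endo = comm_group G for G (structure) +
  fixes \<tau> :: "'a \<Rightarrow> 'a"
  assumes endo: "\<tau> \<in> hom G G"
begin

sublocale endo: group_hom G G \<tau>
  by (unfold_locales) (rule endo)

lemma endo_funpow_closed [simp]: "a \<in> carrier G \<Longrightarrow> (\<tau> ^^ r) a \<in> carrier G"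
  by (induction r) auto

lemma endo_finprod:
  "g \<in> A \<rightarrow> carrier G \<Longrightarrow> \<tau> (\<Otimes>i\<in>A. g i) = (\<Otimes>i\<in>A. \<tau> (g i))"
  by (induction A rule: infinite_finite_induct) (auto simp: Pi_def)

lemma poly_act_closed [simp]: "a \<in> carrier G \<Longrightarrow> poly_act G \<tau> p a \<in> carrier G"
  by (auto simp: poly_act_def)

text \<open>Coefficients beyond the degree vanish. A common bound avoids a case split in
  \<open>poly_act_pCons\<close>, since the degree of \<open>pCons c p\<close> is not
  \<open>Suc\<close> of the degree of \<open>p\<close> when \<open>p = 0\<close>.\<close>

lemma poly_act_bound:
  assumes "a \<in> carrier G" "Polynomial.degree p \<le> n"
  shows "poly_act G \<tau> p a = (\<Otimes>r\<in>{..n}. (\<tau> ^^ r) a [^] Polynomial.coeff p r)"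
  unfolding poly_act_def
  by (rule finprod_mono_neutral_cong_left)
     (use assms in \<open>auto simp: coeff_eq_0\<close>)

lemma poly_act_0 [simp]: "a \<in> carrier G \<Longrightarrow> poly_act G \<tau> 0 a = \<one>"
  by (simp add: poly_act_def)

text \<open>The Horner step: after \<open>r = 0\<close> is split off, one \<open>\<tau>\<close>
  comes out of the remaining product. The algebraic laws of the action follow from it by induction
  on polynomials.\<close>

lemma poly_act_pCons:
  assumes a: "a \<in> carrier G"
  shows "poly_act G \<tau> (pCons c p) a = a [^] c \<otimes> \<tau> (poly_act G \<tau> p a)"
proof -
  let ?n = "Polynomial.degree p"
  have "poly_act G \<tau> (pCons c p) a
      = (\<Otimes>r\<in>{..Suc ?n}. (\<tau> ^^ r) a [^] Polynomial.coeff (pCons c p) r)"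
    using a degree_pCons_le by (rule poly_act_bound)
  also have "\<dots> = (\<Otimes>r\<in>{..?n}. (\<tau> ^^ Suc r) a [^] Polynomial.coeff p r) \<otimes> a [^] c"
    using a by (subst finprod_Suc2) (auto simp del: finprod_Suc funpow.simps)
  also have "(\<Otimes>r\<in>{..?n}. (\<tau> ^^ Suc r) a [^] Polynomial.coeff p r) = \<tau> (poly_act G \<tau> p a)"
    using a by (simp add: poly_act_def endo_finprod endo.hom_int_pow)
  finally show ?thesis
    using a by (simp add: m_comm)
qed

lemma poly_act_1 [simp]: "a \<in> carrier G \<Longrightarrow> poly_act G \<tau> 1 a = a"
  by (simp add: one_pCons poly_act_pCons)

lemma poly_act_X: "a \<in> carrier G \<Longrightarrow> poly_act G \<tau> [:0, 1:] a = \<tau> a"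
  by (simp add: poly_act_pCons)

lemma poly_act_mult_right:
  assumes "a \<in> carrier G" "b \<in> carrier G"
  shows "poly_act G \<tau> p (a \<otimes> b) = poly_act G \<tau> p a \<otimes> poly_act G \<tau> p b"
  by (induction p) (use assms in \<open>simp_all add: poly_act_pCons int_pow_distrib m_ac\<close>)

lemma poly_act_add:
  assumes "a \<in> carrier G"
  shows "poly_act G \<tau> (p + q) a = poly_act G \<tau> p a \<otimes> poly_act G \<tau> q a"
  by (induction p q rule: poly_induct2) (use assms in \<open>simp_all add: poly_act_pCons int_pow_mult m_ac\<close>)

lemma poly_act_smult:
  assumes "a \<in> carrier G"
  shows "poly_act G \<tau> (Polynomial.smult c p) a = poly_act G \<tau> p a [^] c"
  by (induction p)
     (use assms in \<open>simp_all add: poly_act_pCons int_pow_pow int_pow_distrib endo.hom_int_pow mult.commute\<close>)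

lemma poly_act_endo:
  assumes "a \<in> carrier G"
  shows "poly_act G \<tau> p (\<tau> a) = \<tau> (poly_act G \<tau> p a)"
  by (induction p) (use assms in \<open>simp_all add: poly_act_pCons endo.hom_int_pow\<close>)

lemma poly_act_times:
  assumes "a \<in> carrier G"
  shows "poly_act G \<tau> (p * q) a = poly_act G \<tau> p (poly_act G \<tau> q a)"
  by (induction p)
     (use assms in \<open>simp_all add: poly_act_pCons poly_act_add poly_act_smult poly_act_endo\<close>)

end

text \<open>Reduces closure under all polynomials to closure under t; used to see that
  \<open>stabilizer\<close> is a submodule.\<close>

lemma (in comm_group_endo) poly_act_in_subgroup:
  assumes H: "subgroup H G" and endo: "\<And>a. a \<in> H \<Longrightarrow> \<tau> a \<in> H" and a: "a \<in> H"
  shows "poly_act G \<tau> p a \<in> H"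
proof -
  have "a \<in> carrier G"
    using H a by (rule subgroup.mem_carrier)
  then show ?thesis
    by (induction p)
       (use H endo a in \<open>auto simp: poly_act_pCons subgroup.one_closed
          intro: subgroup.m_closed subgroup_int_pow_closed\<close>)
qed

text \<open>Equivariance for t gives equivariance for all polynomials by the Horner step. It
  transports the action from \<open>Dis\<close> to \<open>M\<close> along
  \<open>shift\<close>.\<close>

lemma poly_act_hom:
  assumes "comm_group_endo G \<sigma>" "comm_group_endo H \<tau>" "h \<in> hom G H"
    and comm: "\<And>a. a \<in> carrier G \<Longrightarrow> h (\<sigma> a) = \<tau> (h a)"
    and a: "a \<in> carrier G"
  shows "h (poly_act G \<sigma> p a) = poly_act H \<tau> p (h a)"
proof -
  interpret G: comm_group_endo G \<sigma> by fact
  interpret H: comm_group_endo H \<tau> by fact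
  interpret h: group_hom G H h
    using assms(3) by unfold_locales
  show ?thesis
    by (induction p) (use a in \<open>simp_all add: G.poly_act_pCons H.poly_act_pCons comm h.hom_int_pow\<close>)
qed

section \<open>Modules over a quotient of the integer polynomial ring\<close>

lemma Zt_simps [simp]:
  "carrier Zt = UNIV" "p \<oplus>\<^bsub>Zt\<^esub> q = p + q" "p \<otimes>\<^bsub>Zt\<^esub> q = p * q"
  "\<zero>\<^bsub>Zt\<^esub> = (0 :: int poly)" "\<one>\<^bsub>Zt\<^esub> = (1 :: int poly)"
  by (simp_all add: ring_of_type_algebra_def)

lemma Zt_ideal: "ideal (PIdl\<^bsub>Zt\<^esub> f) Zt"
  by (rule cring.cgenideal_ideal) auto

lemma Zt_quot_cring: "cring (Zt_quot f)"
  unfolding Zt_quot_def using Zt_ideal by (rule ideal.quotient_is_cring) auto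

lemma Zt_class_hom: "Zt_class f \<in> ring_hom Zt (Zt_quot f)"
  unfolding Zt_quot_def Zt_class_def[abs_def] using Zt_ideal by (rule ideal.rcos_ring_hom)

lemma Zt_class_simps:
  "Zt_class f (p + q) = Zt_class f p \<oplus>\<^bsub>Zt_quot f\<^esub> Zt_class f q"
  "Zt_class f (p * q) = Zt_class f p \<otimes>\<^bsub>Zt_quot f\<^esub> Zt_class f q"
  "Zt_class f 1 = \<one>\<^bsub>Zt_quot f\<^esub>"
  using ring_hom_add[OF Zt_class_hom, of p q] ring_hom_mult[OF Zt_class_hom, of p q]
    ring_hom_one[OF Zt_class_hom] by simp_all

lemma Zt_class_closed [simp]: "Zt_class f p \<in> carrier (Zt_quot f)"
  using ring_hom_closed[OF Zt_class_hom] by simp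

lemma carrier_Zt_quot: "carrier (Zt_quot f) = range (Zt_class f)"
  by (auto simp: Zt_quot_def Zt_class_def FactRing_def A_RCOSETS_def' a_r_coset_def')

lemma Zt_class_eq: "Zt_class f p = {p + q * f | q. True}"
  by (auto simp: Zt_class_def a_r_coset_def' cgenideal_def add.commute)

lemma Zt_class_eq_iff: "Zt_class f p = Zt_class f q \<longleftrightarrow> f dvd p - q"
proof
  assume "Zt_class f p = Zt_class f q"
  moreover have "p \<in> Zt_class f p"
    by (auto simp: Zt_class_eq intro: exI[of _ 0])
  ultimately show "f dvd p - q"
    by (auto simp: Zt_class_eq)
next
  assume "f dvd p - q"
  then obtain k where k: "p = q + k * f"
    by (metis add.commute diff_add_cancel dvd_def mult.commute)
  have "\<exists>m. p + l * f = q + m * f" for l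
    by (rule exI[of _ "k + l"]) (simp add: k algebra_simps)
  moreover have "\<exists>m. q + l * f = p + m * f" for l
    by (rule exI[of _ "l - k"]) (simp add: k algebra_simps)
  ultimately show "Zt_class f p = Zt_class f q"
    by (auto simp: Zt_class_eq)
qed

lemma Zt_class_0: "Zt_class f 0 = \<zero>\<^bsub>Zt_quot f\<^esub>"
  by (auto simp: Zt_class_eq Zt_quot_def FactRing_def cgenideal_def)

lemma Zt_class_self: "Zt_class f f = \<zero>\<^bsub>Zt_quot f\<^esub>"
  unfolding Zt_class_0[symmetric] by (simp add: Zt_class_eq_iff)

text \<open>Write f = c + t g with c d = 1. Then t (-d g) = 1 - d f, so the class of -d g is inverse
  to that of t.\<close>

lemma Zt_class_X_Unit:
  assumes "Polynomial.coeff f 0 dvd 1"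
  shows "Zt_class f [:0, 1:] \<in> Units (Zt_quot f)"
proof -
  interpret R: cring "Zt_quot f" by (rule Zt_quot_cring)
  obtain c g where f: "f = pCons c g"
    by (metis pCons_cases)
  with assms obtain d where d: "c * d = 1"
    unfolding dvd_def by (metis coeff_pCons_0)
  let ?u = "Polynomial.smult (- d) g"
  have "[:0, 1:] * ?u - 1 = Polynomial.smult (- d) f"
    using d by (simp add: f one_pCons mult.commute)
  then have "f dvd [:0, 1:] * ?u - 1"
    by (simp add: dvd_smult)
  then have "Zt_class f [:0, 1:] \<otimes>\<^bsub>Zt_quot f\<^esub> Zt_class f ?u = \<one>\<^bsub>Zt_quot f\<^esub>"
    by (simp only: Zt_class_simps[symmetric] Zt_class_eq_iff)
  then show ?thesis
    using R.Units_one_closed R.unit_factor Zt_class_closed by metis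
qed

text \<open>
  The scalar multiplication uses an arbitrary representative of the class. It is meaningful when
  \<open>f\<close> acts trivially: then the choice does not matter.
\<close>
definition poly_module ::
  "int poly \<Rightarrow> ('a, 'b) monoid_scheme \<Rightarrow> ('a \<Rightarrow> 'a) \<Rightarrow> (int poly set, 'a) module"
  where "poly_module f G \<tau> =
    \<lparr>carrier = carrier G, monoid.mult = undefined, monoid.one = undefined,
     ring.zero = \<one>\<^bsub>G\<^esub>, ring.add = (\<otimes>\<^bsub>G\<^esub>),
     module.smult = (\<lambda>C. poly_act G \<tau> (SOME p. Zt_class f p = C))\<rparr>"

lemma poly_module_simps [simp]:
  "carrier (poly_module f G \<tau>) = carrier G"
  "\<zero>\<^bsub>poly_module f G \<tau>\<^esub> = \<one>\<^bsub>G\<^esub>"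
  "a \<oplus>\<^bsub>poly_module f G \<tau>\<^esub> b = a \<otimes>\<^bsub>G\<^esub> b"
  by (simp_all add: poly_module_def)

context comm_group_endo
begin

text \<open>Two representatives of a class differ by a multiple \<open>k * f\<close>, which acts
  trivially because \<open>f\<close> does.\<close>

lemma poly_module_smult:
  assumes f: "\<And>a. a \<in> carrier G \<Longrightarrow> poly_act G \<tau> f a = \<one>" and a: "a \<in> carrier G"
  shows "Zt_class f p \<odot>\<^bsub>poly_module f G \<tau>\<^esub> a = poly_act G \<tau> p a"
proof -
  define q where "q = (SOME q. Zt_class f q = Zt_class f p)"
  have "Zt_class f q = Zt_class f p"
    unfolding q_def by (rule someI) simp
  then obtain k where "q - p = f * k"
    by (auto simp: Zt_class_eq_iff)
  then have "q = p + k * f"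
    by (simp add: algebra_simps)
  then have "poly_act G \<tau> q a = poly_act G \<tau> p a"
    \<comment> \<open>This instance says that \<open>poly_act G \<tau> k \<one>\<close> equals its
      own square, so it is \<one>.\<close>
    using f a poly_act_mult_right[of \<one> \<one> k]
    by (simp add: poly_act_add poly_act_times)
  then show ?thesis
    by (simp add: poly_module_def q_def)
qed

lemma poly_module:
  assumes f: "\<And>a. a \<in> carrier G \<Longrightarrow> poly_act G \<tau> f a = \<one>"
  shows "module (Zt_quot f) (poly_module f G \<tau>)"
proof (rule moduleI)
  show "abelian_group (poly_module f G \<tau>)"
    by (rule abelian_groupI) (auto simp: m_ac intro: l_inv_ex)
qed (auto simp: Zt_quot_cring carrier_Zt_quot poly_module_smult[OF f] poly_act_add
      poly_act_times poly_act_mult_right simp flip: Zt_class_simps)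

end

lemma (in module) smult_endo:
  assumes "r \<in> carrier R"
  shows "comm_group_endo (add_monoid M) (\<lambda>a. r \<odot>\<^bsub>M\<^esub> a)"
proof -
  interpret A: comm_group "add_monoid M" by (rule M.a_comm_group)
  show ?thesis
    by unfold_locales (use assms in \<open>auto simp: hom_def smult_r_distr\<close>)
qed

text \<open>A module over the quotient ring is determined by its additive group and the action of t:
  constants act as integer multiples, and the Horner scheme gives the rest.\<close>

lemma Zt_class_smult:
  assumes "module (Zt_quot f) M" and m: "m \<in> carrier M"
  shows "Zt_class f p \<odot>\<^bsub>M\<^esub> m
    = poly_act (add_monoid M) (\<lambda>a. Zt_class f [:0, 1:] \<odot>\<^bsub>M\<^esub> a) p m"
proof -
  interpret module "Zt_quot f" M by fact
  interpret E: comm_group_endo "add_monoid M" "\<lambda>a. Zt_class f [:0, 1:] \<odot>\<^bsub>M\<^esub> a"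
    by (rule smult_endo) (rule Zt_class_closed)
  have pow: "Zt_class f [:c:] \<odot>\<^bsub>M\<^esub> m = m [^]\<^bsub>add_monoid M\<^esub> c" for c :: int
  proof -
    \<comment> \<open>A homomorphism from the integers is determined by its value at 1, which here
      is \<open>m\<close>.\<close>
    have "(\<lambda>c. Zt_class f [:c:] \<odot>\<^bsub>M\<^esub> m)
      \<in> hom integer_group (add_monoid M)"
      using m by (auto simp: hom_def simp flip: smult_l_distr Zt_class_simps)
    from hom_int_pow[OF this, of 1 c] show ?thesis
      using m M.a_group by (simp add: Zt_class_simps flip: one_pCons)
  qed
  show ?thesis
  proof (induction p)
    case 0
    show ?case
      using m by (simp add: Zt_class_0)
  next
    case (pCons c p)
    have "Zt_class f (pCons c p) = Zt_class f ([:c:] + [:0, 1:] * p)"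
      by simp
    also have "\<dots> \<odot>\<^bsub>M\<^esub> m = m [^]\<^bsub>add_monoid M\<^esub> c \<oplus>\<^bsub>M\<^esub>
        Zt_class f [:0, 1:] \<odot>\<^bsub>M\<^esub> (Zt_class f p \<odot>\<^bsub>M\<^esub> m)"
      using m unfolding Zt_class_simps by (simp add: smult_l_distr smult_assoc1 pow)
    finally show ?case
      using m by (simp add: E.poly_act_pCons pCons.IH)
  qed
qed

section \<open>Direct sums and free bases\<close>

lemma direct_sum_copies_simps [simp]:
  "carrier (direct_sum_copies R I) = {a \<in> I \<rightarrow>\<^sub>E carrier R. finite {i \<in> I. a i \<noteq> \<zero>\<^bsub>R\<^esub>}}"
  "\<zero>\<^bsub>direct_sum_copies R I\<^esub> = (\<lambda>i\<in>I. \<zero>\<^bsub>R\<^esub>)"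
  "a \<oplus>\<^bsub>direct_sum_copies R I\<^esub> b = (\<lambda>i\<in>I. a i \<oplus>\<^bsub>R\<^esub> b i)"
  "r \<odot>\<^bsub>direct_sum_copies R I\<^esub> a = (\<lambda>i\<in>I. r \<otimes>\<^bsub>R\<^esub> a i)"
  by (simp_all add: direct_sum_copies_def)

lemma direct_sum_copies_module:
  fixes R (structure)
  assumes "cring R"
  shows "module R (direct_sum_copies R I)" (is "module R ?M")
proof -
  interpret cring R by fact
  have add: "a \<oplus>\<^bsub>?M\<^esub> b \<in> carrier ?M" if "a \<in> carrier ?M" "b \<in> carrier ?M" for a b
  proof -
    have "{i \<in> I. a i \<oplus> b i \<noteq> \<zero>} \<subseteq> {i \<in> I. a i \<noteq> \<zero>} \<union> {i \<in> I. b i \<noteq> \<zero>}"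
      by auto
    then show ?thesis
      using that by (auto simp: PiE_iff cong: conj_cong intro: finite_subset)
  qed
  have smult: "r \<odot>\<^bsub>?M\<^esub> a \<in> carrier ?M" if "r \<in> carrier R" "a \<in> carrier ?M" for r a
  proof -
    have "{i \<in> I. r \<otimes> a i \<noteq> \<zero>} \<subseteq> {i \<in> I. a i \<noteq> \<zero>}"
      using that by auto
    then show ?thesis
      using that by (auto simp: PiE_iff cong: conj_cong intro: finite_subset)
  qed
  \<comment> \<open>The negative is taken as the multiple by -1, so that its finite support comes
    from \<open>smult\<close>.\<close>
  have neg: "\<exists>b\<in>carrier ?M. b \<oplus>\<^bsub>?M\<^esub> a = \<zero>\<^bsub>?M\<^esub>" if "a \<in> carrier ?M" for a
  proof
    show "\<ominus> \<one> \<odot>\<^bsub>?M\<^esub> a \<in> carrier ?M"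
      using that by (intro smult) auto
    show "\<ominus> \<one> \<odot>\<^bsub>?M\<^esub> a \<oplus>\<^bsub>?M\<^esub> a = \<zero>\<^bsub>?M\<^esub>"
      using that by (auto simp: PiE_iff fun_eq_iff l_minus l_neg)
  qed
  show ?thesis
  proof (rule moduleI)
    show "abelian_group ?M"
    proof (rule abelian_groupI, goal_cases)
      case 1 then show ?case by (rule add)
    next
      case 6 then show ?case by (rule neg)
    qed (auto simp: PiE_iff extensional_def fun_eq_iff a_ac)
  qed (use smult in \<open>auto simp: PiE_iff extensional_def fun_eq_iff l_distr r_distr m_assoc is_cring\<close>)
qed

definition linear_combination ::
  "('r, 'm) ring_scheme \<Rightarrow> ('r, 'a, 'n) module_scheme \<Rightarrow> 'i set \<Rightarrow> ('i \<Rightarrow> 'a) \<Rightarrow> ('i \<Rightarrow> 'r) \<Rightarrow> 'a"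
  where "linear_combination R M I e c = (\<Oplus>\<^bsub>M\<^esub>i\<in>{i \<in> I. c i \<noteq> \<zero>\<^bsub>R\<^esub>}. c i \<odot>\<^bsub>M\<^esub> e i)"

context module
begin

text \<open>Lets two families with different supports be summed over one common finite set.\<close>

lemma linear_combination_superset:
  assumes "finite B" "{i \<in> I. c i \<noteq> \<zero>} \<subseteq> B" "B \<subseteq> I"
    and "c \<in> I \<rightarrow> carrier R" "e \<in> I \<rightarrow> carrier M"
  shows "linear_combination R M I e c = (\<Oplus>\<^bsub>M\<^esub>i\<in>B. c i \<odot>\<^bsub>M\<^esub> e i)"
  unfolding linear_combination_def
  by (rule M.add.finprod_mono_neutral_cong_left) (use assms in \<open>auto simp: Pi_def subset_iff\<close>)

lemma linear_combination_closed:
  assumes "c \<in> I \<rightarrow> carrier R" "e \<in> I \<rightarrow> carrier M"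
  shows "linear_combination R M I e c \<in> carrier M"
  unfolding linear_combination_def by (rule M.finsum_closed) (use assms in auto)

lemma linear_combination_add:
  assumes c: "c \<in> I \<rightarrow> carrier R" "finite {i \<in> I. c i \<noteq> \<zero>}"
    and d: "d \<in> I \<rightarrow> carrier R" "finite {i \<in> I. d i \<noteq> \<zero>}"
    and e: "e \<in> I \<rightarrow> carrier M"
  shows "linear_combination R M I e (c \<oplus>\<^bsub>direct_sum_copies R I\<^esub> d)
    = linear_combination R M I e c \<oplus>\<^bsub>M\<^esub> linear_combination R M I e d"
proof -
  let ?B = "{i \<in> I. c i \<noteq> \<zero>} \<union> {i \<in> I. d i \<noteq> \<zero>}"
  have mem: "c i \<in> carrier R" "d i \<in> carrier R" "e i \<in> carrier M" if "i \<in> I" for i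
    using that c d e by auto
  have "linear_combination R M I e (c \<oplus>\<^bsub>direct_sum_copies R I\<^esub> d)
      = (\<Oplus>\<^bsub>M\<^esub>i\<in>?B. (c \<oplus>\<^bsub>direct_sum_copies R I\<^esub> d) i \<odot>\<^bsub>M\<^esub> e i)"
    by (rule linear_combination_superset) (use c d e in auto)
  also have "\<dots> = (\<Oplus>\<^bsub>M\<^esub>i\<in>?B. c i \<odot>\<^bsub>M\<^esub> e i \<oplus>\<^bsub>M\<^esub> d i \<odot>\<^bsub>M\<^esub> e i)"
    using mem by (intro M.finsum_cong') (auto simp: smult_l_distr)
  also have "\<dots> = (\<Oplus>\<^bsub>M\<^esub>i\<in>?B. c i \<odot>\<^bsub>M\<^esub> e i) \<oplus>\<^bsub>M\<^esub> (\<Oplus>\<^bsub>M\<^esub>i\<in>?B. d i \<odot>\<^bsub>M\<^esub> e i)"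
    using mem by (intro M.finsum_addf) auto
  also have "(\<Oplus>\<^bsub>M\<^esub>i\<in>?B. c i \<odot>\<^bsub>M\<^esub> e i) = linear_combination R M I e c"
    by (rule linear_combination_superset[symmetric]) (use c d e in auto)
  also have "(\<Oplus>\<^bsub>M\<^esub>i\<in>?B. d i \<odot>\<^bsub>M\<^esub> e i) = linear_combination R M I e d"
    by (rule linear_combination_superset[symmetric]) (use c d e in auto)
  finally show ?thesis .
qed

lemma linear_combination_smult:
  assumes c: "c \<in> I \<rightarrow> carrier R" "finite {i \<in> I. c i \<noteq> \<zero>}"
    and e: "e \<in> I \<rightarrow> carrier M" and r: "r \<in> carrier R"
  shows "linear_combination R M I e (r \<odot>\<^bsub>direct_sum_copies R I\<^esub> c)
    = r \<odot>\<^bsub>M\<^esub> linear_combination R M I e c"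
proof -
  let ?B = "{i \<in> I. c i \<noteq> \<zero>}"
  have mem: "c i \<in> carrier R" "e i \<in> carrier M" if "i \<in> I" for i
    using that c e by auto
  have "linear_combination R M I e (r \<odot>\<^bsub>direct_sum_copies R I\<^esub> c)
      = (\<Oplus>\<^bsub>M\<^esub>i\<in>?B. (r \<odot>\<^bsub>direct_sum_copies R I\<^esub> c) i \<odot>\<^bsub>M\<^esub> e i)"
    by (rule linear_combination_superset) (use c e r in auto)
  also have "\<dots> = (\<Oplus>\<^bsub>M\<^esub>i\<in>?B. r \<odot>\<^bsub>M\<^esub> (c i \<odot>\<^bsub>M\<^esub> e i))"
    using mem r by (intro M.finsum_cong') (auto simp: smult_assoc1)
  also have "\<dots> = r \<odot>\<^bsub>M\<^esub> linear_combination R M I e c"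
    unfolding linear_combination_def
    using c mem r by (intro finsum_smult_ldistr[symmetric]) auto
  finally show ?thesis .
qed

lemma linear_combination_unit_vector:
  assumes "e \<in> I \<rightarrow> carrier M" "i \<in> I"
  shows "linear_combination R M I e (\<lambda>j\<in>I. if j = i then \<one> else \<zero>) = e i"
proof -
  have "linear_combination R M I e (\<lambda>j\<in>I. if j = i then \<one> else \<zero>)
      = (\<Oplus>\<^bsub>M\<^esub>j\<in>{i}. (\<lambda>j\<in>I. if j = i then \<one> else \<zero>) j \<odot>\<^bsub>M\<^esub> e j)"
    by (rule linear_combination_superset) (use assms in \<open>auto split: if_splits\<close>)
  also have "\<dots> = e i"
    using assms M.add.finprod_singleton by (auto simp: Pi_iff)
  finally show ?thesis .
qed

end

text \<open>In this form a free basis is one for which the linear map from the direct sum to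
  \<open>M\<close> is bijective; its inverse gives coordinates.\<close>

lemma free_basis_iff:
  "free_basis R M I e \<longleftrightarrow> e \<in> I \<rightarrow> carrier M \<and>
    (\<forall>a\<in>carrier M. \<exists>!c. c \<in> carrier (direct_sum_copies R I) \<and> a = linear_combination R M I e c)"
  by (simp add: free_basis_def linear_combination_def conj_assoc)

lemma free_basis_span:
  assumes "module R M" "free_basis R M I e"
    and H: "submodule H R M" "e ` I \<subseteq> H"
  shows "carrier M \<subseteq> H"
proof
  interpret module R M by fact
  interpret H: submodule H R M by fact
  fix a assume "a \<in> carrier M"
  then obtain c where c: "c \<in> I \<rightarrow>\<^sub>E carrier R"
    and a: "a = (\<Oplus>\<^bsub>M\<^esub>i\<in>{i \<in> I. c i \<noteq> \<zero>\<^bsub>R\<^esub>}. c i \<odot>\<^bsub>M\<^esub> e i)"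
    using assms(2) unfolding free_basis_def by blast
  have "(\<Oplus>\<^bsub>M\<^esub>i\<in>A. c i \<odot>\<^bsub>M\<^esub> e i) \<in> H" if "finite A" "A \<subseteq> I" for A
    using that
  proof (induction A)
    case empty
    show ?case
      using H.one_closed by simp
  next
    case (insert i A)
    have mem: "c j \<odot>\<^bsub>M\<^esub> e j \<in> H" if "j \<in> I" for j
      using that c H(2) by (intro H.smult_closed) auto
    moreover have "H \<subseteq> carrier M"
      using H.subset by simp
    ultimately have "(\<Oplus>\<^bsub>M\<^esub>i\<in>insert i A. c i \<odot>\<^bsub>M\<^esub> e i)
        = c i \<odot>\<^bsub>M\<^esub> e i \<oplus>\<^bsub>M\<^esub> (\<Oplus>\<^bsub>M\<^esub>i\<in>A. c i \<odot>\<^bsub>M\<^esub> e i)"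
      using insert.prems insert.hyps by (intro M.finsum_insert) auto
    then show ?case
      using H.m_closed[OF mem insert.IH] insert.prems by simp
  qed
  from this[of "{i \<in> I. c i \<noteq> \<zero>\<^bsub>R\<^esub>}"] show "a \<in> H"
    \<comment> \<open>In the infinite case the sum takes its default value zero, which lies in
      \<open>H\<close>.\<close>
    using a H.one_closed
    by (cases "finite {i \<in> I. c i \<noteq> \<zero>\<^bsub>R\<^esub>}") (auto simp: M.finsum_infinite)
qed

text \<open>The extension sends \<open>a\<close> to its coordinates and then forms the linear
  combination of \<open>g\<close> in \<open>N\<close>. Coordinates are linear because they invert
  the linear map \<open>?m\<close>.\<close>

lemma free_basis_extend:
  assumes "module R M" "module R N" "free_basis R M I e" and g: "g \<in> I \<rightarrow> carrier N"
  obtains \<psi> where "\<psi> \<in> carrier M \<rightarrow> carrier N"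
    and "\<And>a b. a \<in> carrier M \<Longrightarrow> b \<in> carrier M \<Longrightarrow> \<psi> (a \<oplus>\<^bsub>M\<^esub> b) = \<psi> a \<oplus>\<^bsub>N\<^esub> \<psi> b"
    and "\<And>r a. r \<in> carrier R \<Longrightarrow> a \<in> carrier M \<Longrightarrow> \<psi> (r \<odot>\<^bsub>M\<^esub> a) = r \<odot>\<^bsub>N\<^esub> \<psi> a"
    and "\<And>i. i \<in> I \<Longrightarrow> \<psi> (e i) = g i"
proof -
  interpret M: module R M by fact
  interpret N: module R N by fact
  let ?D = "direct_sum_copies R I"
  interpret D: module R ?D
    by (rule direct_sum_copies_module) (rule M.R.is_cring)
  have e: "e \<in> I \<rightarrow> carrier M"
    using assms(3) by (simp add: free_basis_def)
  let ?m = "linear_combination R M I e" and ?n = "linear_combination R N I g"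
  define coords where
    "coords a = (THE c. c \<in> carrier ?D \<and> a = ?m c)" for a
  have D_E: "c \<in> I \<rightarrow> carrier R" "finite {i \<in> I. c i \<noteq> \<zero>\<^bsub>R\<^esub>}" if "c \<in> carrier ?D" for c
    using that by auto
  have coords: "coords a \<in> carrier ?D" "?m (coords a) = a" if "a \<in> carrier M" for a
  proof -
    have "\<exists>!c. c \<in> carrier ?D \<and> a = ?m c"
      using that assms(3) by (simp only: free_basis_iff)
    from theI'[OF this] show "coords a \<in> carrier ?D" "?m (coords a) = a"
      by (simp_all only: coords_def)
  qed
  \<comment> \<open>The uniqueness half of the basis property. Linearity of \<open>coords\<close> is
    checked below by applying this to sums and multiples of coordinates.\<close>
  have coords_eqI: "coords (?m c) = c" if "c \<in> carrier ?D" for c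
  proof -
    have "?m c \<in> carrier M"
      using D_E[OF that] e by (intro M.linear_combination_closed)
    with that coords[OF this] assms(3) show ?thesis
      by (metis (no_types, lifting) free_basis_iff)
  qed
  show ?thesis
  proof (rule that[of "\<lambda>a. ?n (coords a)"])
    show "(\<lambda>a. ?n (coords a)) \<in> carrier M \<rightarrow> carrier N"
      using D_E(1)[OF coords(1)] g by (blast intro: N.linear_combination_closed)
  next
    fix a b assume ab: "a \<in> carrier M" "b \<in> carrier M"
    note D = coords(1)[OF ab(1)] coords(1)[OF ab(2)]
    have "coords (a \<oplus>\<^bsub>M\<^esub> b) = coords (?m (coords a \<oplus>\<^bsub>?D\<^esub> coords b))"
      by (simp only: M.linear_combination_add[OF D_E[OF D(1)] D_E[OF D(2)] e] coords(2) ab)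
    also have "\<dots> = coords a \<oplus>\<^bsub>?D\<^esub> coords b"
      using D by (intro coords_eqI D.M.a_closed)
    finally show "?n (coords (a \<oplus>\<^bsub>M\<^esub> b)) = ?n (coords a) \<oplus>\<^bsub>N\<^esub> ?n (coords b)"
      by (simp only: N.linear_combination_add[OF D_E[OF D(1)] D_E[OF D(2)] g])
  next
    fix r a assume r: "r \<in> carrier R" and a: "a \<in> carrier M"
    note D = coords(1)[OF a]
    have "coords (r \<odot>\<^bsub>M\<^esub> a) = coords (?m (r \<odot>\<^bsub>?D\<^esub> coords a))"
      by (simp only: M.linear_combination_smult[OF D_E[OF D] e r] coords(2) a)
    also have "\<dots> = r \<odot>\<^bsub>?D\<^esub> coords a"
      using D r by (intro coords_eqI D.smult_closed)
    finally show "?n (coords (r \<odot>\<^bsub>M\<^esub> a)) = r \<odot>\<^bsub>N\<^esub> ?n (coords a)"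
      by (simp only: N.linear_combination_smult[OF D_E[OF D] g r])
  next
    fix i assume i: "i \<in> I"
    let ?c = "\<lambda>j\<in>I. if j = i then \<one>\<^bsub>R\<^esub> else \<zero>\<^bsub>R\<^esub>"
    have "{j \<in> I. ?c j \<noteq> \<zero>\<^bsub>R\<^esub>} \<subseteq> {i}"
      by auto
    then have "finite {j \<in> I. ?c j \<noteq> \<zero>\<^bsub>R\<^esub>}"
      by (rule finite_subset) simp
    then have "?c \<in> carrier ?D"
      by simp
    then have "coords (e i) = ?c"
      using coords_eqI M.linear_combination_unit_vector[OF e i] by metis
    then show "?n (coords (e i)) = g i"
      by (simp only: N.linear_combination_unit_vector[OF g i])
  qed
qed

section \<open>Displacement groups\<close>

lemma BijGroup_simps:
  "carrier (BijGroup Q) = Bij Q"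
  "g \<in> Bij Q \<Longrightarrow> h \<in> Bij Q \<Longrightarrow> x \<in> Q \<Longrightarrow> (g \<otimes>\<^bsub>BijGroup Q\<^esub> h) x = g (h x)"
  "x \<in> Q \<Longrightarrow> \<one>\<^bsub>BijGroup Q\<^esub> x = x"
  by (simp_all add: BijGroup_def compose_eq)

lemma Bij_closed: "g \<in> Bij Q \<Longrightarrow> x \<in> Q \<Longrightarrow> g x \<in> Q"
  using Bij_imp_funcset by fastforce

lemma Bij_eqI:
  assumes "g \<in> Bij Q" "h \<in> Bij Q" "\<And>x. x \<in> Q \<Longrightarrow> g x = h x"
  shows "g = h"
  using assms by (auto intro: extensionalityI[of _ Q] dest: Bij_imp_extensional)

lemma BijGroup_inv_apply:
  assumes "g \<in> Bij Q" "x \<in> Q"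
  shows "(inv\<^bsub>BijGroup Q\<^esub> g) (g x) = x" "g ((inv\<^bsub>BijGroup Q\<^esub> g) x) = x"
proof -
  interpret group "BijGroup Q" by (rule group_BijGroup)
  have "inv\<^bsub>BijGroup Q\<^esub> g \<in> Bij Q"
    using assms inv_closed by (simp add: BijGroup_simps)
  with assms l_inv[of g] r_inv[of g] show
    "(inv\<^bsub>BijGroup Q\<^esub> g) (g x) = x" "g ((inv\<^bsub>BijGroup Q\<^esub> g) x) = x"
    by (metis BijGroup_simps)+
qed

lemma (in group) mult_inv_cancel:
  assumes "x \<in> carrier G" "a \<in> carrier G"
  shows "x \<otimes> (inv x \<otimes> a) = a" "inv x \<otimes> (x \<otimes> a) = a"
  using assms by (simp_all flip: m_assoc)

text \<open>Matches the iterates in \<open>poly_act\<close> with the conjugations by powers in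
  \<open>poly_action\<close>.\<close>

lemma (in group) pow_conj:
  fixes n :: nat
  assumes "x \<in> carrier G" "a \<in> carrier G"
  shows "((\<lambda>b. x \<otimes> b \<otimes> inv x) ^^ n) a = x [^] n \<otimes> a \<otimes> inv (x [^] n)"
proof (induction n)
  case (Suc n)
  have "x \<otimes> (x [^] n \<otimes> a \<otimes> inv (x [^] n)) \<otimes> inv x
      = (x \<otimes> x [^] n) \<otimes> a \<otimes> inv (x \<otimes> x [^] n)"
    using assms by (simp add: inv_mult_group m_assoc)
  then show ?case
    using assms by (simp only: funpow.simps o_apply Suc.IH nat_pow_Suc2)
qed (use assms in simp)

context quandle
begin

interpretation B: group "BijGroup Q"
  by (rule group_BijGroup)

abbreviation B_mult (infixl "\<bullet>" 70)
  where "g \<bullet> h \<equiv> g \<otimes>\<^bsub>BijGroup Q\<^esub> h"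

abbreviation B_inv
  where "B_inv g \<equiv> inv\<^bsub>BijGroup Q\<^esub> g"

abbreviation L
  where "L \<equiv> left_translation"

abbreviation conj_by
  where "conj_by x \<alpha> \<equiv> L x \<bullet> \<alpha> \<bullet> B_inv (L x)"

lemma left_translation_apply [simp]: "y \<in> Q \<Longrightarrow> L x y = x \<star> y"
  by (simp add: left_translation_def)

lemma left_translation_Bij:
  assumes "x \<in> Q"
  shows "L x \<in> Bij Q"
proof -
  have "bij_betw (L x) Q Q"
    unfolding bij_betw_def inj_on_def
    using assms left_division[OF assms] star_closed[OF assms]
    by (auto simp: image_iff) metis+
  then show ?thesis
    by (simp add: Bij_def left_translation_def)
qed

lemma left_translation_closed [simp]: "x \<in> Q \<Longrightarrow> L x \<in> carrier (BijGroup Q)"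
  by (simp add: BijGroup_simps left_translation_Bij)

lemma BijGroup_apply:
  "g \<in> carrier (BijGroup Q) \<Longrightarrow> h \<in> carrier (BijGroup Q) \<Longrightarrow> x \<in> Q \<Longrightarrow> (g \<bullet> h) x = g (h x)"
  "g \<in> carrier (BijGroup Q) \<Longrightarrow> x \<in> Q \<Longrightarrow> g x \<in> Q"
  "g \<in> carrier (BijGroup Q) \<Longrightarrow> x \<in> Q \<Longrightarrow> B_inv g (g x) = x"
  "g \<in> carrier (BijGroup Q) \<Longrightarrow> x \<in> Q \<Longrightarrow> g (B_inv g x) = x"
  using BijGroup_inv_apply by (auto simp: BijGroup_simps Bij_closed)

lemma BijGroup_eqI:
  assumes "g \<in> carrier (BijGroup Q)" "h \<in> carrier (BijGroup Q)" "\<And>x. x \<in> Q \<Longrightarrow> g x = h x"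
  shows "g = h"
  using assms by (auto simp: BijGroup_simps intro: Bij_eqI)

lemma left_div_eq: "x \<in> Q \<Longrightarrow> y \<in> Q \<Longrightarrow> left_div x (x \<star> y) = y"
  unfolding left_div_def
  by (rule the1_equality[OF left_division]) (simp_all add: star_closed)

lemma
  assumes "x \<in> Q" "y \<in> Q"
  shows left_div_closed: "left_div x y \<in> Q" and star_left_div: "x \<star> left_div x y = y"
  using theI'[OF left_division[OF assms]] by (simp_all add: left_div_def)

text \<open>Left distributivity as an identity of permutations reads L_x L_y = L_(x * y)
  L_x.\<close>

lemma left_translation_star:
  assumes "x \<in> Q" "y \<in> Q"
  shows "L (x \<star> y) = conj_by x (L y)"
proof -
  have "L x \<bullet> L y = L (x \<star> y) \<bullet> L x"
    by (rule BijGroup_eqI) (use assms in \<open>simp_all add: BijGroup_apply star_closed flip: left_distrib\<close>)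
  then show ?thesis
    using assms by (subst B.inv_solve_right) (simp_all add: star_closed)
qed

lemma Dis_simps [simp]:
  "(\<otimes>\<^bsub>Dis\<^esub>) = (\<otimes>\<^bsub>BijGroup Q\<^esub>)" "\<one>\<^bsub>Dis\<^esub> = \<one>\<^bsub>BijGroup Q\<^esub>"
  by (simp_all add: Dis_def)

lemma Dis_subgroup: "subgroup (carrier Dis) (BijGroup Q)"
  by (auto simp: Dis_def intro!: B.generate_is_subgroup)

text \<open>Puts \<open>Dis\<close> in the shape of the library facts on subgroups, which carry
  inverses and powers over from \<open>BijGroup Q\<close>.\<close>

lemma Dis_eq: "Dis = (BijGroup Q)\<lparr>carrier := carrier Dis\<rparr>"
  by (simp add: Dis_def)

lemma Dis_in_BijGroup [simp]: "\<alpha> \<in> carrier Dis \<Longrightarrow> \<alpha> \<in> carrier (BijGroup Q)"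
  using Dis_subgroup by (rule subgroup.mem_carrier)

lemma Dis_group: "group Dis"
  using B.subgroup_imp_group[OF Dis_subgroup] by (simp flip: Dis_eq)

lemma Dis_inv: "\<alpha> \<in> carrier Dis \<Longrightarrow> inv\<^bsub>Dis\<^esub> \<alpha> = B_inv \<alpha>"
  using B.m_inv_consistent[OF Dis_subgroup] by (simp flip: Dis_eq)

lemma Dis_int_pow: "\<alpha> \<in> carrier Dis \<Longrightarrow> \<alpha> [^]\<^bsub>Dis\<^esub> (n::int) = \<alpha> [^]\<^bsub>BijGroup Q\<^esub> n"
  using B.int_pow_consistent[OF Dis_subgroup] by (simp flip: Dis_eq)

lemma Dis_displacement [intro]: "x \<in> Q \<Longrightarrow> y \<in> Q \<Longrightarrow> L x \<bullet> B_inv (L y) \<in> carrier Dis"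
  by (auto simp: Dis_def intro: generate.incl)

text \<open>No case for inverses arises: the inverse of L_x L_y^-1 is the generator L_y
  L_x^-1.\<close>

lemma Dis_induct [consumes 1, case_names one displacement mult]:
  assumes "\<alpha> \<in> carrier Dis"
    and one: "P \<one>\<^bsub>BijGroup Q\<^esub>"
    and disp: "\<And>x y. x \<in> Q \<Longrightarrow> y \<in> Q \<Longrightarrow> P (L x \<bullet> B_inv (L y))"
    and mult: "\<And>\<alpha> \<beta>. \<alpha> \<in> carrier Dis \<Longrightarrow> \<beta> \<in> carrier Dis \<Longrightarrow> P \<alpha> \<Longrightarrow> P \<beta> \<Longrightarrow> P (\<alpha> \<bullet> \<beta>)"
  shows "P \<alpha>"
proof -
  let ?G = "{L x \<bullet> B_inv (L y) |x y. x \<in> Q \<and> y \<in> Q}"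
  have "\<alpha> \<in> generate (BijGroup Q) ?G"
    using assms(1) by (simp add: Dis_def)
  then show ?thesis
  proof induction
    case (inv h)
    then show ?case
      using disp by (auto simp: B.inv_mult_group)
  next
    case (eng h1 h2)
    then show ?case
      by (intro mult) (auto simp: Dis_def)
  qed (use one disp in auto)
qed

lemma conj_displacement:
  assumes "x \<in> Q" "y \<in> Q" "w \<in> Q"
  shows "conj_by x (L y \<bullet> B_inv (L w)) = L (x \<star> y) \<bullet> B_inv (L (x \<star> w))"
  using assms by (simp add: left_translation_star B.inv_mult_group B.m_assoc B.mult_inv_cancel)

lemma conj_mult:
  assumes "x \<in> Q" "\<alpha> \<in> carrier (BijGroup Q)" "\<beta> \<in> carrier (BijGroup Q)"
  shows "conj_by x (\<alpha> \<bullet> \<beta>) = conj_by x \<alpha> \<bullet> conj_by x \<beta>"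
  using assms by (simp add: B.m_assoc B.mult_inv_cancel)

text \<open>Conjugation by a left translation maps generators to generators, by
  \<open>conj_displacement\<close>.\<close>

lemma conj_Dis:
  assumes "\<alpha> \<in> carrier Dis" "x \<in> Q"
  shows "conj_by x \<alpha> \<in> carrier Dis"
  using assms(1)
proof (induction rule: Dis_induct)
  case one
  show ?case
    using assms(2) subgroup.one_closed[OF Dis_subgroup] by simp
next
  case (displacement y w)
  then show ?case
    using assms(2) by (auto simp: conj_displacement star_closed)
next
  case (mult \<alpha> \<beta>)
  then show ?case
    using assms(2) subgroup.m_closed[OF Dis_subgroup] by (simp add: conj_mult)
qed

text \<open>Left translations are automorphisms by left distributivity, hence so are their inverses
  and all products of these.\<close>

lemma Dis_automorphism:
  assumes "\<alpha> \<in> carrier Dis" "x \<in> Q" "y \<in> Q"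
  shows "\<alpha> (x \<star> y) = \<alpha> x \<star> \<alpha> y"
  using assms
proof (induction arbitrary: x y rule: Dis_induct)
  case one
  then show ?case
    by (simp add: BijGroup_simps star_closed)
next
  case (displacement u v)
  have inv: "B_inv (L v) w = left_div v w" if "w \<in> Q" for w
    using BijGroup_apply(3)[of "L v" "left_div v w"] displacement that
    by (simp add: left_div_closed star_left_div)
  \<comment> \<open>Distributivity applied to the two quotients shows that L_v^-1 respects the
    operation.\<close>
  have "left_div v (x \<star> y) = left_div v (v \<star> (left_div v x \<star> left_div v y))"
    using displacement left_distrib[of v "left_div v x" "left_div v y"]
    by (simp add: left_div_closed star_left_div)
  also have "\<dots> = left_div v x \<star> left_div v y"
    using displacement by (simp add: left_div_eq left_div_closed star_closed)
  finally show ?case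
    using displacement
    by (simp add: BijGroup_apply inv left_div_closed star_closed flip: left_distrib)
next
  case (mult \<alpha> \<beta>)
  then show ?case
    by (simp add: BijGroup_apply star_closed)
qed

end

section \<open>The displacement group of a medial quandle as a commutative group with an action of
  t\<close>

context medial_quandle
begin

interpretation B: group "BijGroup Q"
  by (rule group_BijGroup)

text \<open>Mediality reads L_(x * y) L_w = L_(x * w) L_y. Expanding by
  \<open>left_translation_star\<close> and cancelling the leading L_x gives the exchange of the
  outer factors.\<close>

lemma left_translation_medial:
  assumes "x \<in> Q" "y \<in> Q" "w \<in> Q"
  shows "L y \<bullet> B_inv (L x) \<bullet> L w = L w \<bullet> B_inv (L x) \<bullet> L y"
proof -
  have "L (x \<star> y) \<bullet> L w = L (x \<star> w) \<bullet> L y"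
    by (rule BijGroup_eqI) (use assms in \<open>auto simp: BijGroup_apply star_closed medial\<close>)
  then show ?thesis
    using assms by (simp add: left_translation_star B.m_assoc)
qed

text \<open>Two exchanges in L_x L_y^-1 L_u L_v^-1: first of L_x and L_u around L_y^-1, then of
  L_y^-1 and L_v^-1 around L_x.\<close>

lemma displacement_commute:
  assumes "x \<in> Q" "y \<in> Q" "u \<in> Q" "v \<in> Q"
  shows "(L x \<bullet> B_inv (L y)) \<bullet> (L u \<bullet> B_inv (L v)) = (L u \<bullet> B_inv (L v)) \<bullet> (L x \<bullet> B_inv (L y))"
proof -
  \<comment> \<open>The exchange law for inverses, obtained by inverting
    \<open>left_translation_medial\<close>.\<close>
  have "B_inv (L y) \<bullet> L x \<bullet> B_inv (L v) = B_inv (L v \<bullet> B_inv (L x) \<bullet> L y)"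
    using assms by (simp add: B.inv_mult_group B.m_assoc)
  also have "\<dots> = B_inv (L y \<bullet> B_inv (L x) \<bullet> L v)"
    using assms left_translation_medial by simp
  also have "\<dots> = B_inv (L v) \<bullet> L x \<bullet> B_inv (L y)"
    using assms by (simp add: B.inv_mult_group B.m_assoc)
  finally have *: "B_inv (L y) \<bullet> L x \<bullet> B_inv (L v) = B_inv (L v) \<bullet> L x \<bullet> B_inv (L y)" .
  have "(L x \<bullet> B_inv (L y) \<bullet> L u) \<bullet> B_inv (L v) = (L u \<bullet> B_inv (L y) \<bullet> L x) \<bullet> B_inv (L v)"
    using assms left_translation_medial by simp
  also have "\<dots> = L u \<bullet> (B_inv (L y) \<bullet> L x \<bullet> B_inv (L v))"
    using assms by (simp add: B.m_assoc)
  also have "\<dots> = L u \<bullet> (B_inv (L v) \<bullet> L x \<bullet> B_inv (L y))"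
    by (simp only: *)
  finally show ?thesis
    using assms by (simp add: B.m_assoc)
qed

text \<open>Commutation passes from generators to products, first in the left argument
  (\<open>disp\<close>) and then in the right one.\<close>

lemma Dis_commute:
  assumes "\<alpha> \<in> carrier Dis" "\<beta> \<in> carrier Dis"
  shows "\<alpha> \<bullet> \<beta> = \<beta> \<bullet> \<alpha>"
proof -
  have product: "(\<alpha> \<bullet> \<alpha>') \<bullet> \<beta> = \<beta> \<bullet> (\<alpha> \<bullet> \<alpha>')"
    if "\<alpha> \<bullet> \<beta> = \<beta> \<bullet> \<alpha>" "\<alpha>' \<bullet> \<beta> = \<beta> \<bullet> \<alpha>'"
      "\<alpha> \<in> carrier (BijGroup Q)" "\<alpha>' \<in> carrier (BijGroup Q)" "\<beta> \<in> carrier (BijGroup Q)"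
    for \<alpha> \<alpha>' \<beta>
    using that by (metis B.m_assoc)
  have disp: "\<alpha> \<bullet> (L u \<bullet> B_inv (L v)) = (L u \<bullet> B_inv (L v)) \<bullet> \<alpha>"
    if "\<alpha> \<in> carrier Dis" "u \<in> Q" "v \<in> Q" for \<alpha> u v
    using that
  proof (induction rule: Dis_induct)
    case (displacement x y)
    then show ?case
      by (simp only: displacement_commute)
  next
    case (mult \<alpha> \<alpha>')
    then show ?case
      by (intro product) auto
  qed simp
  show ?thesis
    using assms(2,1)
  proof (induction rule: Dis_induct)
    case (displacement u v)
    then show ?case
      by (simp only: disp)
  next
    case (mult \<beta> \<beta>')
    then show ?case
      by (intro product[symmetric]) auto
  qed simp
qed

lemma Dis_comm_group: "comm_group Dis"
  using Dis_group by (rule group.group_comm_groupI) (simp add: Dis_commute)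

lemma Dis_conj_endo:
  assumes "x \<in> Q"
  shows "comm_group_endo Dis (conj_by x)"
proof (intro comm_group_endo.intro comm_group_endo_axioms.intro)
  show "comm_group Dis"
    by (rule Dis_comm_group)
  show "conj_by x \<in> hom Dis Dis"
    using assms by (intro homI) (simp_all add: conj_Dis conj_mult)
qed

text \<open>The two conjugates of \<alpha> are themselves conjugate by the displacement L_x L_y^-1,
  and \<open>Dis\<close> is commutative.\<close>

lemma conj_eq:
  assumes "x \<in> Q" "y \<in> Q" "\<alpha> \<in> carrier Dis"
  shows "conj_by x \<alpha> = conj_by y \<alpha>"
proof -
  let ?\<beta> = "L x \<bullet> B_inv (L y)"
  have "conj_by x \<alpha> \<bullet> ?\<beta> = ?\<beta> \<bullet> conj_by y \<alpha>"
    using assms by (simp add: B.m_assoc B.mult_inv_cancel)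
  also have "\<dots> = conj_by y \<alpha> \<bullet> ?\<beta>"
    using assms by (intro Dis_commute) (auto simp: conj_Dis)
  finally show ?thesis
    using assms by simp
qed

text \<open>The bridge from the definition of f-quandles to the general calculus of
  \<open>poly_act\<close>.\<close>

lemma poly_action_eq_poly_act:
  assumes "\<alpha> \<in> carrier Dis" "x \<in> Q"
  shows "poly_action f x \<alpha> = poly_act Dis (conj_by x) f \<alpha>"
proof -
  interpret D: comm_group_endo Dis "conj_by x"
    using assms(2) by (rule Dis_conj_endo)
  have "poly_act Dis (conj_by x) f \<alpha> = (\<Otimes>\<^bsub>Dis\<^esub>r\<in>{..Polynomial.degree f}.
      (conj_by x ^^ r) \<alpha> [^]\<^bsub>BijGroup Q\<^esub> Polynomial.coeff f r)"
    using assms by (simp add: poly_act_def Dis_int_pow)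
  also have "\<dots> = poly_action f x \<alpha>"
    using assms by (simp add: poly_action_def B.pow_conj)
  finally show ?thesis ..
qed

end

section \<open>Affine quandles over a module\<close>

text \<open>Rewrite rules that pull all subtractions outward, into one difference of two sums, and
  then clear it from equations. With commutativity and distributivity they settle the affine
  identities below.\<close>

lemma (in abelian_group) minus_normalize:
  assumes "a \<in> carrier G" "b \<in> carrier G" "c \<in> carrier G"
  shows "a \<oplus> (b \<ominus> c) = (a \<oplus> b) \<ominus> c" "(a \<ominus> b) \<oplus> c = (a \<oplus> c) \<ominus> b"
    "(a \<ominus> b) \<ominus> c = a \<ominus> (b \<oplus> c)" "a \<ominus> (b \<ominus> c) = (a \<oplus> c) \<ominus> b"
    "a \<ominus> b = c \<longleftrightarrow> a = c \<oplus> b" "c = a \<ominus> b \<longleftrightarrow> c \<oplus> b = a"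
proof -
  show "a \<ominus> b = c \<longleftrightarrow> a = c \<oplus> b"
    using assms by (auto simp: a_minus_def a_assoc l_neg r_neg)
  then show "c = a \<ominus> b \<longleftrightarrow> c \<oplus> b = a"
    by auto
qed (use assms in \<open>simp_all add: a_minus_def minus_add a_ac\<close>)

lemma (in abelian_group) minus_zero: "a \<in> carrier G \<Longrightarrow> a \<ominus> \<zero> = a"
  by (simp add: minus_normalize)

lemma (in module) smult_minus:
  "r \<in> carrier R \<Longrightarrow> a \<in> carrier M \<Longrightarrow> b \<in> carrier M \<Longrightarrow> r \<odot>\<^bsub>M\<^esub> (a \<ominus>\<^bsub>M\<^esub> b) = r \<odot>\<^bsub>M\<^esub> a \<ominus>\<^bsub>M\<^esub> r \<odot>\<^bsub>M\<^esub> b"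
  by (simp add: a_minus_def smult_r_distr smult_r_minus)

text \<open>Invertibility of \<open>t\<close> is what makes left division possible in
  \<open>F\<close>.\<close>

locale affine_quandle = module R M for R (structure) and M (structure) +
  fixes t :: 'a and e :: "'i \<Rightarrow> 'c" and S :: "'i set"
  assumes t: "t \<in> Units R" and e: "e \<in> S \<rightarrow> carrier M"
begin

abbreviation F where "F \<equiv> carrier M \<times> S"
abbreviation star (infixl "\<star>" 70) where "star \<equiv> affine_star R M t e"

lemma t_closed [simp]: "t \<in> carrier R"
  using t by (rule R.Units_closed)

lemma e_closed [simp]: "i \<in> S \<Longrightarrow> e i \<in> carrier M"
  using e by auto

lemmas group_normalize = M.minus_normalize M.a_ac smult_minus smult_r_distr

text \<open>Expands (1 - t) a and gathers positive and negative terms, the form on which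
  \<open>group_normalize\<close> works.\<close>

lemma star_eq:
  assumes "a \<in> carrier M" "b \<in> carrier M" "i \<in> S" "j \<in> S"
  shows "(a, i) \<star> (b, j) = ((a \<oplus>\<^bsub>M\<^esub> e i \<oplus>\<^bsub>M\<^esub> t \<odot>\<^bsub>M\<^esub> b) \<ominus>\<^bsub>M\<^esub> (t \<odot>\<^bsub>M\<^esub> a \<oplus>\<^bsub>M\<^esub> e j), j)"
proof -
  have "(\<one> \<ominus> t) \<odot>\<^bsub>M\<^esub> a = a \<ominus>\<^bsub>M\<^esub> t \<odot>\<^bsub>M\<^esub> a"
    using assms by (simp add: a_minus_def smult_l_distr smult_l_minus)
  then show ?thesis
    using assms by (simp add: affine_star_def group_normalize)
qed

text \<open>The second coordinate forces the index \<open>j\<close>; the first leaves an equation t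
  b = d, solved with the inverse of \<open>t\<close>.\<close>

lemma star_division:
  assumes "a \<in> carrier M" "c \<in> carrier M" "i \<in> S" "j \<in> S"
  shows "\<exists>!u. u \<in> F \<and> (a, i) \<star> u = (c, j)"
proof -
  let ?d = "(c \<oplus>\<^bsub>M\<^esub> t \<odot>\<^bsub>M\<^esub> a \<oplus>\<^bsub>M\<^esub> e j) \<ominus>\<^bsub>M\<^esub> (a \<oplus>\<^bsub>M\<^esub> e i)"
  have iff: "(a, i) \<star> (b, k) = (c, j) \<longleftrightarrow> t \<odot>\<^bsub>M\<^esub> b = ?d \<and> k = j"
    if "b \<in> carrier M" "k \<in> S" for b k
    using assms that by (auto simp: star_eq group_normalize)
  have "t \<odot>\<^bsub>M\<^esub> b = ?d \<longleftrightarrow> b = inv t \<odot>\<^bsub>M\<^esub> ?d" if "b \<in> carrier M" for b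
    using assms that t smult_assoc1[of t "inv t" ?d] smult_assoc1[of "inv t" t b] by auto
  with iff show ?thesis
    using assms t by (intro ex1I[of _ "(inv t \<odot>\<^bsub>M\<^esub> ?d, j)"]) auto
qed

sublocale medial_quandle F star
proof
  fix x y assume "x \<in> F" "y \<in> F"
  then show "x \<star> y \<in> F"
    by (auto simp: star_eq)
next
  fix x y w assume "x \<in> F" "y \<in> F" "w \<in> F"
  then show "x \<star> (y \<star> w) = (x \<star> y) \<star> (x \<star> w)"
    by (auto simp: star_eq group_normalize)
next
  fix x y assume "x \<in> F" "y \<in> F"
  then show "\<exists>!u. u \<in> F \<and> x \<star> u = y"
    by (elim SigmaE) (simp only: star_division)
next
  fix x assume "x \<in> F"
  then show "x \<star> x = x"
    by (auto simp: star_eq group_normalize)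
next
  fix x y u v assume "x \<in> F" "y \<in> F" "u \<in> F" "v \<in> F"
  then show "(x \<star> y) \<star> (u \<star> v) = (x \<star> u) \<star> (y \<star> v)"
    by (auto simp: star_eq group_normalize)
qed

section \<open>Displacements of an affine quandle as translations\<close>

definition translates :: "('c \<times> 'i \<Rightarrow> 'c \<times> 'i) \<Rightarrow> 'c \<Rightarrow> bool"
  where "translates \<alpha> m \<longleftrightarrow>
    m \<in> carrier M \<and> (\<forall>c\<in>carrier M. \<forall>j\<in>S. \<alpha> (c, j) = (c \<oplus>\<^bsub>M\<^esub> m, j))"

lemma translates_mult:
  assumes "\<alpha> \<in> carrier Dis" "\<beta> \<in> carrier Dis" "translates \<alpha> m" "translates \<beta> n"
  shows "translates (\<alpha> \<otimes>\<^bsub>Dis\<^esub> \<beta>) (m \<oplus>\<^bsub>M\<^esub> n)"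
  using assms by (auto simp: translates_def BijGroup_apply M.a_ac)

text \<open>Left translations keep the second coordinate, so the preimage of \<open>(c, j)\<close>
  has index \<open>j\<close> again.\<close>

lemma left_translation_surj:
  assumes "x \<in> F" "c \<in> carrier M" "j \<in> S"
  obtains b where "b \<in> carrier M" "(c, j) = x \<star> (b, j)"
proof -
  have "(c, j) \<in> F"
    using assms by simp
  then obtain b k where bk: "b \<in> carrier M" "k \<in> S" "x \<star> (b, k) = (c, j)"
    using left_division[OF assms(1)] by (metis SigmaE)
  obtain a i where "x = (a, i)" "a \<in> carrier M" "i \<in> S"
    using assms(1) by auto
  with bk have "k = j"
    by (simp add: star_eq)
  with bk show ?thesis
    using that by metis
qed

text \<open>On points of a fixed index, L_x is an affine map with linear part t. Both signs are
  stated because \<open>stabilizer\<close> asks for both.\<close>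

lemma star_shift:
  assumes "x \<in> F" "d \<in> carrier M" "j \<in> S" "m \<in> carrier M" "(c, j) = x \<star> (d, j)"
  shows "x \<star> (d \<oplus>\<^bsub>M\<^esub> m, j) = (c \<oplus>\<^bsub>M\<^esub> t \<odot>\<^bsub>M\<^esub> m, j)"
    and "x \<star> (d \<ominus>\<^bsub>M\<^esub> m, j) = (c \<ominus>\<^bsub>M\<^esub> t \<odot>\<^bsub>M\<^esub> m, j)"
proof -
  obtain a i where x: "x = (a, i)" "a \<in> carrier M" "i \<in> S"
    using assms(1) by auto
  have "c = (a \<oplus>\<^bsub>M\<^esub> e i \<oplus>\<^bsub>M\<^esub> t \<odot>\<^bsub>M\<^esub> d) \<ominus>\<^bsub>M\<^esub> (t \<odot>\<^bsub>M\<^esub> a \<oplus>\<^bsub>M\<^esub> e j)"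
    using assms x by (simp add: star_eq)
  then show "x \<star> (d \<oplus>\<^bsub>M\<^esub> m, j) = (c \<oplus>\<^bsub>M\<^esub> t \<odot>\<^bsub>M\<^esub> m, j)"
    "x \<star> (d \<ominus>\<^bsub>M\<^esub> m, j) = (c \<ominus>\<^bsub>M\<^esub> t \<odot>\<^bsub>M\<^esub> m, j)"
    using assms(2-4) x(2,3) by (simp_all add: x(1) star_eq group_normalize)
qed

text \<open>In L_x L_y^-1 the terms e_j cancel, so a single vector serves for all indices
  \<open>j\<close>.\<close>

lemma Dis_translates: "\<alpha> \<in> carrier Dis \<Longrightarrow> \<exists>m. translates \<alpha> m"
proof (induction rule: Dis_induct)
  case one
  show ?case
    by (intro exI[of _ "\<zero>\<^bsub>M\<^esub>"]) (auto simp: translates_def BijGroup_simps)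
next
  case (displacement x y)
  interpret B: group "BijGroup F" by (rule group_BijGroup)
  obtain a i b k where xy: "x = (a, i)" "y = (b, k)"
    and [simp]: "a \<in> carrier M" "i \<in> S" "b \<in> carrier M" "k \<in> S"
    using displacement by auto
  \<comment> \<open>This is (1 - t) (a - b) + e_i - e_k, written as a difference of two
    sums.\<close>
  let ?m = "(a \<oplus>\<^bsub>M\<^esub> e i \<oplus>\<^bsub>M\<^esub> t \<odot>\<^bsub>M\<^esub> b) \<ominus>\<^bsub>M\<^esub> (t \<odot>\<^bsub>M\<^esub> a \<oplus>\<^bsub>M\<^esub> b \<oplus>\<^bsub>M\<^esub> e k)"
  have "(L x \<otimes>\<^bsub>BijGroup F\<^esub> inv\<^bsub>BijGroup F\<^esub> L y) (c, j) = (c \<oplus>\<^bsub>M\<^esub> ?m, j)"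
    if cj: "c \<in> carrier M" "j \<in> S" for c j
  proof -
    obtain d where d: "d \<in> carrier M" "(c, j) = y \<star> (d, j)"
      using displacement(2) cj by (rule left_translation_surj)
    then have "(inv\<^bsub>BijGroup F\<^esub> L y) (c, j) = (d, j)"
      using displacement cj BijGroup_apply(3)[of "L y" "(d, j)"] by simp
    moreover have "c = (b \<oplus>\<^bsub>M\<^esub> e k \<oplus>\<^bsub>M\<^esub> t \<odot>\<^bsub>M\<^esub> d) \<ominus>\<^bsub>M\<^esub> (t \<odot>\<^bsub>M\<^esub> b \<oplus>\<^bsub>M\<^esub> e j)"
      using d cj by (simp add: xy star_eq)
    then have "x \<star> (d, j) = (c \<oplus>\<^bsub>M\<^esub> ?m, j)"
      using d(1) cj(2) by (simp add: xy star_eq group_normalize)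
    ultimately show ?thesis
      using displacement d(1) cj by (simp add: BijGroup_apply)
  qed
  then show ?case
    by (intro exI[of _ ?m]) (auto simp: translates_def)
next
  case (mult \<alpha> \<beta>)
  then show ?case
    by (blast intro: translates_mult[unfolded Dis_simps])
qed

text \<open>Conjugating a translation by an affine map applies the linear part of that map, here t,
  to the vector.\<close>

lemma translates_conj:
  assumes "\<alpha> \<in> carrier Dis" "translates \<alpha> m" "x \<in> F"
  shows "translates (conj_by x \<alpha>) (t \<odot>\<^bsub>M\<^esub> m)"
proof -
  interpret B: group "BijGroup F" by (rule group_BijGroup)
  have m: "m \<in> carrier M"
    using assms by (simp add: translates_def)
  have "conj_by x \<alpha> (c, j) = (c \<oplus>\<^bsub>M\<^esub> t \<odot>\<^bsub>M\<^esub> m, j)" if cj: "c \<in> carrier M" "j \<in> S" for c j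
  proof -
    obtain d where d: "d \<in> carrier M" "(c, j) = x \<star> (d, j)"
      using assms(3) cj by (rule left_translation_surj)
    then have "(inv\<^bsub>BijGroup F\<^esub> L x) (c, j) = (d, j)"
      using assms cj BijGroup_apply(3)[of "L x" "(d, j)"] by simp
    moreover have "\<alpha> (d, j) = (d \<oplus>\<^bsub>M\<^esub> m, j)"
      using assms(2) d cj by (simp add: translates_def)
    moreover have "x \<star> (d \<oplus>\<^bsub>M\<^esub> m, j) = (c \<oplus>\<^bsub>M\<^esub> t \<odot>\<^bsub>M\<^esub> m, j)"
      using assms(3) d(1) cj(2) m d(2) by (rule star_shift)
    ultimately show ?thesis
      using assms d(1) cj m by (simp add: BijGroup_apply)
  qed
  then show ?thesis
    using m by (auto simp: translates_def)
qed

definition shift :: "('c \<times> 'i \<Rightarrow> 'c \<times> 'i) \<Rightarrow> 'c"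
  where "shift \<alpha> = (THE m. translates \<alpha> m)"

text \<open>The vector can be read off at a point \<open>(\<zero>, j)\<close>, which exists because
  \<open>S\<close> is nonempty.\<close>

lemma shift_eqI:
  assumes "S \<noteq> {}" "translates \<alpha> m"
  shows "shift \<alpha> = m"
  unfolding shift_def
proof (rule the_equality)
  obtain j where "j \<in> S"
    using assms(1) by auto
  fix n assume "translates \<alpha> n"
  with assms(2) \<open>j \<in> S\<close> show "n = m"
    by (metis M.add.l_cancel M.zero_closed prod.inject translates_def)
qed fact

lemma translates_shift:
  assumes "S \<noteq> {}" "\<alpha> \<in> carrier Dis"
  shows "translates \<alpha> (shift \<alpha>)"
  using assms Dis_translates shift_eqI by blast

lemma shift_hom:
  assumes "S \<noteq> {}"
  shows "shift \<in> hom Dis (add_monoid M)"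
proof (rule homI)
  fix \<alpha> \<beta> assume "\<alpha> \<in> carrier Dis" "\<beta> \<in> carrier Dis"
  then show "shift (\<alpha> \<otimes>\<^bsub>Dis\<^esub> \<beta>) = shift \<alpha> \<otimes>\<^bsub>add_monoid M\<^esub> shift \<beta>"
    using assms by (auto intro!: shift_eqI translates_mult translates_shift simp del: Dis_simps)
next
  fix \<alpha> assume "\<alpha> \<in> carrier Dis"
  then show "shift \<alpha> \<in> carrier (add_monoid M)"
    using translates_shift[OF assms] by (auto simp: translates_def)
qed

text \<open>By \<open>translates_conj\<close>, \<open>shift\<close> turns conjugation into
  multiplication by t, so it turns the action of f into that of f on \<open>M\<close>.\<close>

lemma shift_poly_action:
  assumes "\<alpha> \<in> carrier Dis" "x \<in> F"
  shows "shift (poly_action f x \<alpha>) = poly_act (add_monoid M) (\<lambda>a. t \<odot>\<^bsub>M\<^esub> a) f (shift \<alpha>)"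
proof -
  have S: "S \<noteq> {}"
    using assms(2) by auto
  have "shift (conj_by x \<beta>) = t \<odot>\<^bsub>M\<^esub> shift \<beta>" if "\<beta> \<in> carrier Dis" for \<beta>
    using that assms(2) S by (intro shift_eqI translates_conj translates_shift)
  then show ?thesis
    unfolding poly_action_eq_poly_act[OF assms]
    using poly_act_hom[OF Dis_conj_endo[OF assms(2)] smult_endo[OF t_closed] shift_hom[OF S] _ assms(1)]
    by blast
qed

text \<open>Injectivity of \<open>shift\<close>: it reduces triviality of the action on
  \<open>Dis\<close> to a computation in \<open>M\<close>.\<close>

lemma Dis_eq_one_if_shift_zero:
  assumes "S \<noteq> {}" "\<alpha> \<in> carrier Dis" "shift \<alpha> = \<zero>\<^bsub>M\<^esub>"
  shows "\<alpha> = \<one>\<^bsub>Dis\<^esub>"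
proof -
  interpret B: group "BijGroup F" by (rule group_BijGroup)
  show ?thesis
    using translates_shift[OF assms(1,2)] assms
    by (auto simp: translates_def BijGroup_simps(3) intro!: BijGroup_eqI)
qed

section \<open>The subquandle generated by the zero section\<close>

abbreviation zero_section where "zero_section \<equiv> {(\<zero>\<^bsub>M\<^esub>, i) | i. i \<in> S}"

lemma generated_subset: "generated zero_section \<subseteq> F"
proof
  fix x assume "x \<in> generated zero_section"
  then show "x \<in> F"
  proof induction
    case (left_div x y)
    then show ?case
      by (intro left_div_closed)
  qed (auto intro: star_closed simp: star_eq)
qed

text \<open>Translation by \<open>m\<close> and by its negative are both required, so that the set
  is closed under negation.\<close>

definition stabilizer :: "'c set"
  where "stabilizer = {m \<in> carrier M. \<forall>c j. (c, j) \<in> generated zero_section \<longrightarrow>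
    (c \<oplus>\<^bsub>M\<^esub> m, j) \<in> generated zero_section \<and> (c \<ominus>\<^bsub>M\<^esub> m, j) \<in> generated zero_section}"

lemma stabilizer_subgroup: "subgroup stabilizer (add_monoid M)"
proof (rule group.subgroupI)
  show "group (add_monoid M)"
    by (rule M.a_group)
  show "stabilizer \<subseteq> carrier (add_monoid M)"
    by (auto simp: stabilizer_def)
  have "\<zero>\<^bsub>M\<^esub> \<in> stabilizer"
    using generated_subset by (auto simp: stabilizer_def M.minus_zero)
  then show "stabilizer \<noteq> {}"
    by auto
next
  fix m assume "m \<in> stabilizer"
  then have "\<ominus>\<^bsub>M\<^esub> m \<in> stabilizer"
    by (auto simp: stabilizer_def a_minus_def)
  then show "inv\<^bsub>add_monoid M\<^esub> m \<in> stabilizer"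
    by (simp add: a_inv_def)
next
  fix m n assume mn: "m \<in> stabilizer" "n \<in> stabilizer"
  have "(c \<oplus>\<^bsub>M\<^esub> (m \<oplus>\<^bsub>M\<^esub> n), j) \<in> generated zero_section \<and>
      (c \<ominus>\<^bsub>M\<^esub> (m \<oplus>\<^bsub>M\<^esub> n), j) \<in> generated zero_section"
    if c: "(c, j) \<in> generated zero_section" for c j
  proof -
    have "c \<in> carrier M" "m \<in> carrier M" "n \<in> carrier M"
      using c mn generated_subset by (auto simp: stabilizer_def)
    then show ?thesis
      using c mn by (simp add: stabilizer_def M.a_assoc[symmetric] M.minus_normalize(3)[symmetric])
  qed
  then show "m \<otimes>\<^bsub>add_monoid M\<^esub> n \<in> stabilizer"
    using mn by (auto simp: stabilizer_def)
qed

text \<open>Write x = (0, z). Both L_x and its inverse preserve the generated set, and translation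
  by t m is the conjugate by L_x of translation by m: divide by x, translate, multiply by x.\<close>

lemma stabilizer_smult:
  assumes m: "m \<in> stabilizer" and z: "z \<in> S"
  shows "t \<odot>\<^bsub>M\<^esub> m \<in> stabilizer"
proof -
  let ?x = "(\<zero>\<^bsub>M\<^esub>, z)"
  have x: "?x \<in> generated zero_section" "?x \<in> F"
    using z by (auto intro: generated.base)
  have mM: "m \<in> carrier M"
    using m by (simp add: stabilizer_def)
  have "(c \<oplus>\<^bsub>M\<^esub> t \<odot>\<^bsub>M\<^esub> m, j) \<in> generated zero_section \<and>
      (c \<ominus>\<^bsub>M\<^esub> t \<odot>\<^bsub>M\<^esub> m, j) \<in> generated zero_section"
    if c: "(c, j) \<in> generated zero_section" for c j
  proof -
    have cj: "c \<in> carrier M" "j \<in> S"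
      using c generated_subset by auto
    obtain d where d: "d \<in> carrier M" "(c, j) = ?x \<star> (d, j)"
      using x(2) cj by (rule left_translation_surj)
    have "left_div ?x (c, j) = (d, j)"
      unfolding d(2) using x(2) d(1) cj(2) by (intro left_div_eq) auto
    then have "(d, j) \<in> generated zero_section"
      using generated.left_div[OF x(1) c] by simp
    then have "?x \<star> (d \<oplus>\<^bsub>M\<^esub> m, j) \<in> generated zero_section" "?x \<star> (d \<ominus>\<^bsub>M\<^esub> m, j) \<in> generated zero_section"
      using m x by (auto simp: stabilizer_def intro: generated.star)
    moreover have "?x \<star> (d \<oplus>\<^bsub>M\<^esub> m, j) = (c \<oplus>\<^bsub>M\<^esub> t \<odot>\<^bsub>M\<^esub> m, j)"
      "?x \<star> (d \<ominus>\<^bsub>M\<^esub> m, j) = (c \<ominus>\<^bsub>M\<^esub> t \<odot>\<^bsub>M\<^esub> m, j)"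
      using star_shift[OF x(2) d(1) cj(2) mM d(2)] by simp_all
    ultimately show ?thesis
      by simp
  qed
  then show ?thesis
    using mM by (auto simp: stabilizer_def)
qed

text \<open>The displacement of (0, k) and (0, l) translates by e_k - e_l and preserves the
  generated set. Taking \<open>z\<close> for one of the two indices leaves e_i or its negative, as
  e_z = 0.\<close>

lemma stabilizer_generator:
  assumes z: "z \<in> S" "e z = \<zero>\<^bsub>M\<^esub>" and i: "i \<in> S"
  shows "e i \<in> stabilizer"
proof -
  have gen: "(\<zero>\<^bsub>M\<^esub>, k) \<in> generated zero_section" "(\<zero>\<^bsub>M\<^esub>, k) \<in> F" if "k \<in> S" for k
    using that by (auto intro: generated.base)
  have move: "(c \<oplus>\<^bsub>M\<^esub> e k \<ominus>\<^bsub>M\<^esub> e l, j) \<in> generated zero_section"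
    if c: "(c, j) \<in> generated zero_section" and kl: "k \<in> S" "l \<in> S" for c j k l
  proof -
    have cj: "c \<in> carrier M" "j \<in> S"
      using c generated_subset by auto
    obtain d where d: "d \<in> carrier M" "(c, j) = (\<zero>\<^bsub>M\<^esub>, l) \<star> (d, j)"
      using gen(2)[OF kl(2)] cj by (rule left_translation_surj)
    have "left_div (\<zero>\<^bsub>M\<^esub>, l) (c, j) = (d, j)"
      unfolding d(2) using gen(2)[OF kl(2)] d(1) cj(2) by (intro left_div_eq) auto
    then have "(d, j) \<in> generated zero_section"
      using generated.left_div[OF gen(1)[OF kl(2)] c] by simp
    with gen(1)[OF kl(1)] have "(\<zero>\<^bsub>M\<^esub>, k) \<star> (d, j) \<in> generated zero_section"
      by (rule generated.star)
    moreover have "c = (e l \<oplus>\<^bsub>M\<^esub> t \<odot>\<^bsub>M\<^esub> d) \<ominus>\<^bsub>M\<^esub> e j"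
      using d cj kl by (simp add: star_eq)
    then have "(\<zero>\<^bsub>M\<^esub>, k) \<star> (d, j) = (c \<oplus>\<^bsub>M\<^esub> e k \<ominus>\<^bsub>M\<^esub> e l, j)"
      using d(1) cj(2) kl by (simp add: star_eq group_normalize)
    ultimately show ?thesis
      by simp
  qed
  have "(c \<oplus>\<^bsub>M\<^esub> e i, j) \<in> generated zero_section \<and> (c \<ominus>\<^bsub>M\<^esub> e i, j) \<in> generated zero_section"
    if c: "(c, j) \<in> generated zero_section" for c j
    using move[OF c i z(1)] move[OF c z(1) i] c i z generated_subset
    by (auto simp: M.minus_zero)
  then show ?thesis
    using i by (auto simp: stabilizer_def)
qed

lemma generated_eq_if_stabilizer:
  assumes "carrier M \<subseteq> stabilizer"
  shows "generated zero_section = F"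
proof
  show "F \<subseteq> generated zero_section"
  proof
    fix x assume "x \<in> F"
    then obtain m j where x: "x = (m, j)" "m \<in> carrier M" "j \<in> S"
      by auto
    then have "(\<zero>\<^bsub>M\<^esub>, j) \<in> generated zero_section"
      by (auto intro: generated.base)
    with assms x have "(\<zero>\<^bsub>M\<^esub> \<oplus>\<^bsub>M\<^esub> m, j) \<in> generated zero_section"
      unfolding stabilizer_def by blast
    with x show "x \<in> generated zero_section"
      by simp
  qed
qed (rule generated_subset)

end

section \<open>Freeness\<close>

text \<open>The translation vector of the image under f is the class of f times a vector, hence
  zero, and \<open>shift\<close> is injective.\<close>

lemma affine_f_quandle:
  assumes "affine_quandle (Zt_quot f) M (Zt_class f [:0, 1:]) e S"
  shows "f_quandle f (carrier M \<times> S) (affine_star (Zt_quot f) M (Zt_class f [:0, 1:]) e)"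
proof -
  interpret affine_quandle "Zt_quot f" M "Zt_class f [:0, 1:]" e S by fact
  have "poly_action f x \<alpha> = \<one>\<^bsub>Dis\<^esub>" if \<alpha>: "\<alpha> \<in> carrier Dis" and x: "x \<in> F" for \<alpha> x
  proof -
    interpret D: comm_group_endo Dis "conj_by x"
      using x by (rule Dis_conj_endo)
    have S: "S \<noteq> {}"
      using x by auto
    then have "shift \<alpha> \<in> carrier M"
      using translates_shift[OF _ \<alpha>] by (simp add: translates_def)
    then have "shift (poly_action f x \<alpha>) = \<zero>\<^bsub>M\<^esub>"
      by (simp add: shift_poly_action[OF \<alpha> x] Zt_class_self
          flip: Zt_class_smult[OF module_axioms])
    moreover have "poly_action f x \<alpha> \<in> carrier Dis"
      using \<alpha> by (simp add: poly_action_eq_poly_act[OF \<alpha> x])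
    ultimately show ?thesis
      using S by (intro Dis_eq_one_if_shift_zero)
  qed
  then show ?thesis
    by unfold_locales
qed

lemma affine_quandle_generated:
  assumes "affine_quandle (Zt_quot f) M (Zt_class f [:0, 1:]) e S"
    and basis: "free_basis (Zt_quot f) M (S - {z}) e" and z: "z \<in> S" "e z = \<zero>\<^bsub>M\<^esub>"
  shows "quandle.generated (carrier M \<times> S) (affine_star (Zt_quot f) M (Zt_class f [:0, 1:]) e)
    {(\<zero>\<^bsub>M\<^esub>, i) | i. i \<in> S} = carrier M \<times> S"
proof -
  interpret affine_quandle "Zt_quot f" M "Zt_class f [:0, 1:]" e S by fact
  interpret E: comm_group_endo "add_monoid M" "\<lambda>a. Zt_class f [:0, 1:] \<odot>\<^bsub>M\<^esub> a"
    by (rule smult_endo) (rule t_closed)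
  have "submodule stabilizer (Zt_quot f) M"
  proof (intro submodule.intro submodule_axioms.intro stabilizer_subgroup)
    fix r m assume r: "r \<in> carrier (Zt_quot f)" and m: "m \<in> stabilizer"
    obtain p where p: "r = Zt_class f p"
      using r by (auto simp: carrier_Zt_quot)
    have "m \<in> carrier M"
      using m by (simp add: stabilizer_def)
    with m show "r \<odot>\<^bsub>M\<^esub> m \<in> stabilizer"
      using E.poly_act_in_subgroup[OF stabilizer_subgroup stabilizer_smult[OF _ z(1)] m]
      by (simp add: p Zt_class_smult[OF module_axioms])
  qed
  moreover have "e ` (S - {z}) \<subseteq> stabilizer"
    using stabilizer_generator[OF z] by auto
  ultimately have "carrier M \<subseteq> stabilizer"
    using free_basis_span[OF module_axioms basis] by blast
  then show ?thesis
    by (rule generated_eq_if_stabilizer)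
qed

text \<open>Let A = \<psi>(a) and B = \<psi>(b). The first coordinate of the product goes to A
  L_(x_i) A^-1 B L_(x_j)^-1. Applied to x_j, which L_(x_j) fixes, this gives A(x_i * A^-1 B(x_j)),
  and A is an automorphism.\<close>

lemma affine_quandle_extend:
  assumes "affine_quandle (Zt_quot f) M (Zt_class f [:0, 1:]) e S"
    and basis: "free_basis (Zt_quot f) M (S - {z}) e" and z: "z \<in> S" "e z = \<zero>\<^bsub>M\<^esub>"
    and Q: "f_quandle f Q star\<^sub>Q" and x: "x \<in> S \<rightarrow> Q"
  obtains h where
    "h \<in> quandle_hom (carrier M \<times> S) (affine_star (Zt_quot f) M (Zt_class f [:0, 1:]) e) Q star\<^sub>Q"
    "\<And>i. i \<in> S \<Longrightarrow> h (\<zero>\<^bsub>M\<^esub>, i) = x i"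
proof -
  let ?t = "Zt_class f [:0, 1:]"
  interpret F: affine_quandle "Zt_quot f" M ?t e S by fact
  interpret Q: f_quandle f Q star\<^sub>Q by fact
  interpret B: group "BijGroup Q" by (rule group_BijGroup)
  have x: "x i \<in> Q" if "i \<in> S" for i
    using that x by auto
  let ?D = "Q.Dis" and ?\<tau> = "Q.conj_by (x z)" and ?N = "poly_module f Q.Dis (Q.conj_by (x z))"
  interpret D: comm_group_endo ?D ?\<tau>
    using x[OF z(1)] by (rule Q.Dis_conj_endo)
  have f: "poly_act ?D ?\<tau> f \<alpha> = \<one>\<^bsub>?D\<^esub>" if "\<alpha> \<in> carrier ?D" for \<alpha>
    using Q.poly_action_trivial[OF that x[OF z(1)]] Q.poly_action_eq_poly_act[OF that x[OF z(1)]]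
    by simp
  have N: "module (Zt_quot f) ?N"
    using f by (rule D.poly_module)
  interpret N: module "Zt_quot f" ?N by (rule N)
  define g where "g i = Q.L (x i) \<otimes>\<^bsub>BijGroup Q\<^esub> inv\<^bsub>BijGroup Q\<^esub> Q.L (x z)" for i
  have "g \<in> S - {z} \<rightarrow> carrier ?N"
    using x z(1) Q.Dis_displacement by (simp add: g_def)
  with F.module_axioms N basis obtain \<psi> where \<psi>: "\<psi> \<in> carrier M \<rightarrow> carrier ?N"
    and \<psi>_add: "\<And>a b. a \<in> carrier M \<Longrightarrow> b \<in> carrier M \<Longrightarrow> \<psi> (a \<oplus>\<^bsub>M\<^esub> b) = \<psi> a \<oplus>\<^bsub>?N\<^esub> \<psi> b"
    and \<psi>_smult: "\<And>r a. r \<in> carrier (Zt_quot f) \<Longrightarrow> a \<in> carrier M \<Longrightarrow> \<psi> (r \<odot>\<^bsub>M\<^esub> a) = r \<odot>\<^bsub>?N\<^esub> \<psi> a"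
    and \<psi>_e: "\<And>i. i \<in> S - {z} \<Longrightarrow> \<psi> (e i) = g i"
    by (rule free_basis_extend) blast
  have \<psi>_closed [simp]: "\<psi> a \<in> carrier ?D" if "a \<in> carrier M" for a
    using \<psi> that by auto
  have \<psi>_hom: "\<psi> \<in> hom (add_monoid M) ?D"
    by (rule homI) (simp_all add: \<psi>_add)
  interpret \<psi>: group_hom "add_monoid M" ?D \<psi>
    using \<psi>_hom F.M.a_group Q.Dis_group by (simp add: group_hom_def group_hom_axioms_def)
  have \<psi>_zero: "\<psi> \<zero>\<^bsub>M\<^esub> = \<one>\<^bsub>BijGroup Q\<^esub>"
    using \<psi>.hom_one by simp
  have \<psi>_minus: "\<psi> (a \<ominus>\<^bsub>M\<^esub> b) = \<psi> a \<otimes>\<^bsub>BijGroup Q\<^esub> inv\<^bsub>BijGroup Q\<^esub> \<psi> b"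
    if "a \<in> carrier M" "b \<in> carrier M" for a b
    using that \<psi>.hom_inv[of b] by (simp add: a_minus_def \<psi>_add a_inv_def Q.Dis_inv)
  \<comment> \<open>The module \<open>?N\<close> uses conjugation by the translation of
    \<open>x z\<close>; by \<open>conj_eq\<close> any other \<open>x i\<close> gives the same action
    of t.\<close>
  have \<psi>_t: "\<psi> (?t \<odot>\<^bsub>M\<^esub> a) = Q.conj_by (x i) (\<psi> a)" if "a \<in> carrier M" "i \<in> S" for a i
    using that \<psi>_smult[of ?t a] D.poly_module_smult[OF f, of "\<psi> a" "[:0, 1:]"]
      Q.conj_eq[OF x[OF that(2)] x[OF z(1)], of "\<psi> a"]
    by (simp add: D.poly_act_X)
  \<comment> \<open>The formula persists at \<open>z\<close>, where e_z = 0 and \<open>g z\<close>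
    is the identity.\<close>
  have \<psi>_e: "\<psi> (e i) = g i" if "i \<in> S" for i
    using that \<psi>_e z x by (cases "i = z") (auto simp: g_def \<psi>_zero)
  define h where "h = (\<lambda>(a, i). \<psi> a (x i))"
  show ?thesis
  proof
    show "h (\<zero>\<^bsub>M\<^esub>, i) = x i" if "i \<in> S" for i
      using that x by (simp add: h_def \<psi>_zero BijGroup_simps)
    have "h (F.star (a, i) (b, j)) = star\<^sub>Q (h (a, i)) (h (b, j))"
      if [simp]: "a \<in> carrier M" "b \<in> carrier M" "i \<in> S" "j \<in> S" for a b i j
    proof -
      let ?A = "\<psi> a" and ?B = "\<psi> b"
      let ?mult = "Q.B_mult" and ?inv = "Q.B_inv"
      note [simp] = x
      \<comment> \<open>The argument of \<psi> is first regrouped as a + (t (b - a) + (e_i - e_j)),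
        so that t acts on a single displacement, which is then reordered to \<open>?G\<close> by
        commutativity.\<close>
      let ?G = "?mult (?inv ?A) ?B"
      have "\<psi> ((a \<oplus>\<^bsub>M\<^esub> e i \<oplus>\<^bsub>M\<^esub> ?t \<odot>\<^bsub>M\<^esub> b) \<ominus>\<^bsub>M\<^esub> (?t \<odot>\<^bsub>M\<^esub> a \<oplus>\<^bsub>M\<^esub> e j))
          = \<psi> (a \<oplus>\<^bsub>M\<^esub> (?t \<odot>\<^bsub>M\<^esub> (b \<ominus>\<^bsub>M\<^esub> a) \<oplus>\<^bsub>M\<^esub> (e i \<ominus>\<^bsub>M\<^esub> e j)))"
        by (rule arg_cong[of _ _ \<psi>]) (simp add: F.group_normalize)
      also have "\<dots> = ?mult ?A (?mult (Q.conj_by (x i) (?mult ?B (?inv ?A))) (?mult (g i) (?inv (g j))))"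
        by (simp add: \<psi>_add \<psi>_minus \<psi>_t[OF _ \<open>i \<in> S\<close>] \<psi>_e)
      also have "?mult (g i) (?inv (g j)) = ?mult (Q.L (x i)) (?inv (Q.L (x j)))"
        using z by (simp add: g_def B.inv_mult_group B.m_assoc B.mult_inv_cancel)
      also have "?mult ?B (?inv ?A) = ?G"
        using subgroup.m_inv_closed[OF Q.Dis_subgroup] by (intro Q.Dis_commute) simp_all
      also have "?mult (Q.conj_by (x i) ?G) (?mult (Q.L (x i)) (?inv (Q.L (x j))))
          = ?mult (Q.L (x i)) (?mult ?G (?inv (Q.L (x j))))"
        by (simp add: B.m_assoc B.mult_inv_cancel)
      finally have "h (F.star (a, i) (b, j))
          = ?mult ?A (?mult (Q.L (x i)) (?mult ?G (?inv (Q.L (x j))))) (x j)"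
        by (simp add: h_def F.star_eq)
      \<comment> \<open>Idempotence makes \<open>x j\<close> a fixed point of its own
        translation.\<close>
      also have "?inv (Q.L (x j)) (x j) = x j"
        using Q.BijGroup_apply(3)[of "Q.L (x j)" "x j"] by (simp add: Q.idem)
      then have "?mult ?A (?mult (Q.L (x i)) (?mult ?G (?inv (Q.L (x j))))) (x j)
          = ?A (star\<^sub>Q (x i) (?inv ?A (?B (x j))))"
        by (simp add: Q.BijGroup_apply)
      also have "\<dots> = star\<^sub>Q (?A (x i)) (?A (?inv ?A (?B (x j))))"
        by (intro Q.Dis_automorphism) (simp_all add: Q.BijGroup_apply)
      also have "\<dots> = star\<^sub>Q (h (a, i)) (h (b, j))"
        by (simp add: h_def Q.BijGroup_apply)
      finally show ?thesis .
    qed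
    moreover have "h \<in> F.F \<rightarrow> Q"
      using x by (auto simp: h_def Q.BijGroup_apply(2))
    ultimately show "h \<in> quandle_hom F.F F.star Q star\<^sub>Q"
      by (auto simp: quandle_hom_def)
  qed
qed

theorem theorem4p7:
  fixes f :: "int poly" and S :: "'x set" and z :: 'x
    and R :: "int poly set ring"
    and M :: "(int poly set, 'x \<Rightarrow> int poly set) module"
    and e :: "'x \<Rightarrow> ('x \<Rightarrow> int poly set)"
  assumes "Polynomial.lead_coeff f dvd 1" and "Polynomial.coeff f 0 dvd 1"
    and "z \<in> S"
    and "R = Zt_quot f"
    and "M = direct_sum_copies R (S - {z})"
    and "free_basis R M (S - {z}) e"
    and "e z = \<zero>\<^bsub>M\<^esub>"
  shows "free_f_quandle TYPE('q) f (carrier M \<times> S) (affine_star R M (Zt_class f [:0, 1:]) e)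
    {(\<zero>\<^bsub>M\<^esub>, i) | i. i \<in> S}"
proof -
  interpret module R M
    unfolding assms(4,5) by (rule direct_sum_copies_module) (rule Zt_quot_cring)
  have "e i \<in> carrier M" if "i \<in> S" for i
    using that assms(6,7) by (cases "i = z") (auto simp: free_basis_def)
  \<comment> \<open>The unit constant coefficient of \<open>f\<close> makes the class of t
    invertible.\<close>
  then have affine: "affine_quandle (Zt_quot f) M (Zt_class f [:0, 1:]) e S"
    using Zt_class_X_Unit[OF assms(2)] module_axioms
    by (auto simp: affine_quandle_def affine_quandle_axioms_def assms(4))
  note basis = assms(6)[unfolded assms(4)]
  have "\<exists>h\<in>quandle_hom (carrier M \<times> S) (affine_star R M (Zt_class f [:0, 1:]) e) Q star\<^sub>Q.
      \<forall>y\<in>{(\<zero>\<^bsub>M\<^esub>, i) | i. i \<in> S}. h y = \<phi> y"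
    if "f_quandle f Q star\<^sub>Q" "\<phi> \<in> {(\<zero>\<^bsub>M\<^esub>, i) | i. i \<in> S} \<rightarrow> Q"
    for Q :: "'q set" and star\<^sub>Q \<phi>
  proof -
    have "(\<lambda>i. \<phi> (\<zero>\<^bsub>M\<^esub>, i)) \<in> S \<rightarrow> Q"
      using that(2) by auto
    from affine_quandle_extend[OF affine basis assms(3,7) that(1) this]
    obtain h where "h \<in> quandle_hom (carrier M \<times> S) (affine_star R M (Zt_class f [:0, 1:]) e) Q star\<^sub>Q"
      "\<And>i. i \<in> S \<Longrightarrow> h (\<zero>\<^bsub>M\<^esub>, i) = \<phi> (\<zero>\<^bsub>M\<^esub>, i)"
      unfolding assms(4) by blast
    then show ?thesis
      by (intro bexI[of _ h]) auto
  qed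
  then show ?thesis
    using affine_f_quandle[OF affine] affine_quandle_generated[OF affine basis assms(3,7)]
    unfolding free_f_quandle_def assms(4) by auto
qed

end
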